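(* Let favors be substitutable and let $B^*$ be the cooperation bound. A network $g$ on $N$ is constrained-efficient if and only if $d_i(g)=B^*$ for all $i\in N$.
   Context: Networks. $N=\{1,\dots,n\}$ is a finite set of players. A network $g$ is an undirected simple graph on $N$, viewed as its set of links; $N_i(g)=\{j: ij\in g\}$, $d_i(g)=|N_i(g)|$. Parameters: $\alpha\in(0,1]$, $p\in(0,1)$, $\delta\in(0,1)$, $v>c>0$, $\gamma\in[0,c)$. Favor exchange game (substitutable favors). Time is $t=0,1,2,\dots$; $g_t$ is the network at the beginning of period $t$, and $g_0=g$ is common knowledge. In each period: (i) players decide, for each of their links, to keep ($K$) or remove ($R$) it; (ii) any player needs a favor with probability $\alpha$ (for simplicity, at most one player requires a favor in a given period); (iii) each other player is independently able to provide the favor in that period with probability $p$; (iv) if some current neighbors of the requester $i$ are able, one of them, $j$, is selected uniformly at random; (v) $j$ chooses $C$ (payoff $v$ to $i$, $-c$ to $j$) or $D$ (payoff $0$ to $i$, $-\gamma$ to $j$). All other payoffs are $0$; discount factor $\delta$. Player $i$ observes with whom she plays, the action profiles in periods in which she plays, and $N_i(g_t)$, but not $g_t$. A strategy $\sigma_i(h_{t,i},j)$ gives, for each private history $h_{t,i}$ and $j\neq i$, a distribution over decisions toward $j$. The bilateral history $h_{t,ij}$ contains only the periods and action profiles of past interactions between $i$ and $j$; $\sigma$ is measurable with respect to bilateral histories if $\sigma_i(h_{t,i},j)=\sigma_i(h'_{t,i},j)$ whenever $h_{t,ij}=h'_{t,ij}$. $(g,\sigma)$ is a bilateral equilibrium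 if $\sigma$ is measurable with respect to bilateral histories and is part of a sequential equilibrium of the game with $g_0=g$. A network $g$ is stable if there is a bilateral equilibrium $(g,\sigma)$ in which on the equilibrium path all favors are provided and all links are kept. Per-period payoff in $g$ when all favors are provided: $u_i(g)=\alpha v\big(1-(1-p)^{d_i(g)}\big)-\sum_{j\in N_i(g)}\alpha c\,\frac{1-(1-p)^{d_j(g)}}{d_j(g)}$. Cooperation bound. $B^*$ is the non-negative integer such that $\delta\alpha v(1-p)^{m-1}p-\delta\alpha c\frac{1-(1-p)^m}{m}\ge(1-\delta)(c-\gamma)$ holds for all positive integers $m\le B^*$ and fails for all $m>B^*$. (No player has more than $B^*$ links in a stable network, and networks in which all players have $B^*$ links are stable.) Constrained efficiency. A network $g$ is constrained-efficient if for all stable networks $g'$ on $N$, $u_i(g)\ge u_i(g')$ for all $i\in N$.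
   Formalization: Constrained-efficient here also requires g itself to be stable (else the complete network on n > B*+1 players is a counterexample), n > B* is assumed (for n ≤ B* the complete network is efficient but not B*-regular), and nα ≤ 1 is explicit, as "at most one requester" entails. *)

theory Defs
  imports "HOL-Probability.Product_PMF"
begin

section \<open>Networks\<close>

text \<open>The player set is the universe of a finite type; a network is a set of two-element sets.\<close>

type_synonym 'a network = "'a set set"

definition network :: "'a network \<Rightarrow> bool" where
  "network g \<longleftrightarrow> (\<forall>e\<in>g. card e = 2)"

definition neighbors :: "'a network \<Rightarrow> 'a \<Rightarrow> 'a set" where
  "neighbors g i = {j. {i, j} \<in> g}"

definition network_degree :: "'a network \<Rightarrow> 'a \<Rightarrow> nat" where
  "network_degree g i = card (neighbors g i)"

section \<open>Histories and strategies\<close>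

datatype link_decision = Keep | Remove

datatype favor_decision = Cooperate | Defect

text \<open>
  A link profile assigns to the ordered pair (i, j) the decision of i about the link between
  i and j; pairs that are not linked carry the dummy value \<^const>\<open>Keep\<close>.
  A play (i, j, a) says that j was selected to provide a favor to i and chose a.
  A history lists the past periods, the most recent one first.
\<close>

type_synonym 'a link_profile = "'a \<times> 'a \<Rightarrow> link_decision"
type_synonym 'a play = "'a \<times> 'a \<times> favor_decision"
type_synonym 'a period = "'a link_profile \<times> 'a play option"
type_synonym 'a history = "'a period list"

text \<open>A link survives iff both of its ends keep it; removed links never come back.\<close>

definition prune :: "'a network \<Rightarrow> 'a link_profile \<Rightarrow> 'a network" where
  "prune g d = {e \<in> g. \<forall>i j. e = {i, j} \<longrightarrow> d (i, j) = Keep}"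

primrec current_network :: "'a network \<Rightarrow> 'a history \<Rightarrow> 'a network" where
  "current_network g [] = g"
| "current_network g (x # h) = prune (current_network g h) (fst x)"

text \<open>
  For each past period, a player recalls her own link decisions, and observes her neighborhood
  after the link stage and the play of that period if she took part in it.  She observes neither
  the link decisions and plays of others nor who was able to provide favors.
\<close>

type_synonym 'a link_info = "('a \<Rightarrow> link_decision) \<times> 'a set"
type_synonym 'a private_history = "('a link_info \<times> 'a play option) list"

definition own_play :: "'a \<Rightarrow> 'a play option \<Rightarrow> 'a play option" where
  "own_play i x = (case x of None \<Rightarrow> None
     | Some (r, q, a) \<Rightarrow> if i = r \<or> i = q then Some (r, q, a) else None)"

definition link_info :: "'a network \<Rightarrow> 'a \<Rightarrow> 'a history \<Rightarrow> 'a link_profile \<Rightarrow> 'a link_info" where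
  "link_info g i h d = ((\<lambda>j. d (i, j)), neighbors (prune (current_network g h) d) i)"

primrec private_history :: "'a network \<Rightarrow> 'a \<Rightarrow> 'a history \<Rightarrow> 'a private_history" where
  "private_history g i [] = []"
| "private_history g i (x # h) =
     (link_info g i h (fst x), own_play i (snd x)) # private_history g i h"

text \<open>
  Link decisions are taken at the beginning of a period.  The favor decision is taken
  towards the requester, given the private history at the beginning of the period and the
  outcome of its link stage.
\<close>

record 'a strategy =
  link_choice :: "'a private_history \<Rightarrow> 'a \<Rightarrow> link_decision pmf"
  favor_choice :: "'a private_history \<Rightarrow> 'a link_info \<Rightarrow> 'a \<Rightarrow> favor_decision pmf"

type_synonym 'a profile = "'a \<Rightarrow> 'a strategy"

text \<open>
  The bilateral history has one entry per past period, which is \<^const>\<open>None\<close> unless i and j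
  interacted with each other in that period; in particular it determines the date.
\<close>

definition bilateral_history :: "'a \<Rightarrow> 'a \<Rightarrow> 'a private_history \<Rightarrow> 'a play option list" where
  "bilateral_history i j x =
     map (\<lambda>(_, y). case y of None \<Rightarrow> None
        | Some (r, q, a) \<Rightarrow> if {r, q} = {i, j} then Some (r, q, a) else None) x"

definition bilaterally_measurable :: "'a profile \<Rightarrow> bool" where
  "bilaterally_measurable \<sigma> \<longleftrightarrow>
     (\<forall>i j x x'. j \<noteq> i \<and> bilateral_history i j x = bilateral_history i j x' \<longrightarrow>
        link_choice (\<sigma> i) x j = link_choice (\<sigma> i) x' j \<and>
        (\<forall>l l'. favor_choice (\<sigma> i) x l j = favor_choice (\<sigma> i) x' l' j))"

definition totally_mixed :: "'a profile \<Rightarrow> bool" where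
  "totally_mixed \<sigma> \<longleftrightarrow>
     (\<forall>i x j. set_pmf (link_choice (\<sigma> i) x j) = UNIV \<and>
        (\<forall>l. set_pmf (favor_choice (\<sigma> i) x l j) = UNIV))"

definition profile_tendsto :: "(nat \<Rightarrow> 'a profile) \<Rightarrow> 'a profile \<Rightarrow> bool" where
  "profile_tendsto s \<sigma> \<longleftrightarrow>
     (\<forall>i x j. (\<forall>b. (\<lambda>k. pmf (link_choice (s k i) x j) b)
                 \<longlonglongrightarrow> pmf (link_choice (\<sigma> i) x j) b) \<and>
        (\<forall>l a. (\<lambda>k. pmf (favor_choice (s k i) x l j) a)
                 \<longlonglongrightarrow> pmf (favor_choice (\<sigma> i) x l j) a))"

text \<open>
  Decision nodes: the link stage after a history h, where all players move, and the favor stage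
  after h and link profile d, where provider q has been selected by requester r.
\<close>

datatype 'a node = Link_Node "'a history" | Favor_Node "'a history" "'a link_profile" 'a 'a

fun moves_at :: "'a \<Rightarrow> 'a node \<Rightarrow> bool" where
  "moves_at i (Link_Node h) \<longleftrightarrow> True"
| "moves_at i (Favor_Node h d r q) \<longleftrightarrow> q = i"

fun observed :: "'a network \<Rightarrow> 'a \<Rightarrow> 'a node \<Rightarrow> 'a private_history \<times> ('a link_info \<times> 'a) option" where
  "observed g i (Link_Node h) = (private_history g i h, None)"
| "observed g i (Favor_Node h d r q) = (private_history g i h, Some (link_info g i h d, r))"

section \<open>The favor exchange game\<close>

locale favor_exchange =
  fixes \<alpha> p \<delta> v c \<gamma> :: real
begin

text \<open>
  At most one player needs a favor in a period, and each given player does so with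
  probability \<open>\<alpha>\<close>; this presupposes \<open>CARD('a) * \<alpha> \<le> 1\<close>.
\<close>

definition requester_pmf :: "'a::finite option pmf" where
  "requester_pmf =
     do { b \<leftarrow> bernoulli_pmf (real CARD('a) * \<alpha>);
          if b then map_pmf Some (pmf_of_set UNIV) else return_pmf None }"

text \<open>The pair of requester and selected provider, if any.\<close>

definition meeting_pmf :: "'a::finite network \<Rightarrow> ('a \<times> 'a) option pmf" where
  "meeting_pmf g =
     do { x \<leftarrow> requester_pmf;
          case x of
            None \<Rightarrow> return_pmf None
          | Some r \<Rightarrow>
              do { able \<leftarrow> Pi_pmf (UNIV - {r}) False (\<lambda>_. bernoulli_pmf p);
                   let A = {q \<in> neighbors g r. able q} in
                   if A = {} then return_pmf None
                   else map_pmf (\<lambda>q. Some (r, q)) (pmf_of_set A) } }"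

definition link_pmf :: "'a::finite network \<Rightarrow> 'a profile \<Rightarrow> 'a history \<Rightarrow> 'a link_profile pmf" where
  "link_pmf g \<sigma> h =
     Pi_pmf {(i, j). {i, j} \<in> current_network g h} Keep
       (\<lambda>(i, j). link_choice (\<sigma> i) (private_history g i h) j)"

definition favor_pmf ::
  "'a network \<Rightarrow> 'a profile \<Rightarrow> 'a history \<Rightarrow> 'a link_profile \<Rightarrow> 'a \<Rightarrow> 'a \<Rightarrow> favor_decision pmf" where
  "favor_pmf g \<sigma> h d r q = favor_choice (\<sigma> q) (private_history g q h) (link_info g q h d) r"

definition period_pmf :: "'a::finite network \<Rightarrow> 'a profile \<Rightarrow> 'a history \<Rightarrow> 'a period pmf" where
  "period_pmf g \<sigma> h =
     do { d \<leftarrow> link_pmf g \<sigma> h;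
          m \<leftarrow> meeting_pmf (prune (current_network g h) d);
          case m of
            None \<Rightarrow> return_pmf (d, None)
          | Some (r, q) \<Rightarrow> map_pmf (\<lambda>a. (d, Some (r, q, a))) (favor_pmf g \<sigma> h d r q) }"

text \<open>The history reached from \<open>h\<close> after \<open>k\<close> further periods.\<close>

primrec run :: "'a::finite network \<Rightarrow> 'a profile \<Rightarrow> 'a history \<Rightarrow> nat \<Rightarrow> 'a history pmf" where
  "run g \<sigma> h 0 = return_pmf h"
| "run g \<sigma> h (Suc k) =
     do { h' \<leftarrow> run g \<sigma> h k; map_pmf (\<lambda>x. x # h') (period_pmf g \<sigma> h') }"

definition payoff :: "'a \<Rightarrow> 'a period \<Rightarrow> real" where
  "payoff i x = (case snd x of
       None \<Rightarrow> 0
     | Some (r, q, Cooperate) \<Rightarrow> if i = r then v else if i = q then - c else 0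
     | Some (r, q, Defect) \<Rightarrow> if i = q then - \<gamma> else 0)"

text \<open>Expected payoffs from \<open>h\<close> onwards, discounted to the period that follows \<open>h\<close>.\<close>

definition discounted_payoff :: "'a::finite network \<Rightarrow> 'a profile \<Rightarrow> 'a \<Rightarrow> 'a history \<Rightarrow> real" where
  "discounted_payoff g \<sigma> i h =
     (\<Sum>k. \<delta> ^ k * measure_pmf.expectation (run g \<sigma> h (Suc k)) (\<lambda>h'. payoff i (hd h')))"

fun node_payoff :: "'a::finite network \<Rightarrow> 'a profile \<Rightarrow> 'a \<Rightarrow> 'a node \<Rightarrow> real" where
  "node_payoff g \<sigma> i (Link_Node h) = discounted_payoff g \<sigma> i h"
| "node_payoff g \<sigma> i (Favor_Node h d r q) =
     measure_pmf.expectation (favor_pmf g \<sigma> h d r q)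
       (\<lambda>a. payoff i (d, Some (r, q, a))
            + \<delta> * discounted_payoff g \<sigma> i ((d, Some (r, q, a)) # h))"

subsection \<open>Sequential equilibrium\<close>

fun reach_prob :: "'a::finite network \<Rightarrow> 'a profile \<Rightarrow> 'a node \<Rightarrow> real" where
  "reach_prob g \<sigma> (Link_Node h) = pmf (run g \<sigma> [] (length h)) h"
| "reach_prob g \<sigma> (Favor_Node h d r q) =
     pmf (run g \<sigma> [] (length h)) h * pmf (link_pmf g \<sigma> h) d
       * pmf (meeting_pmf (prune (current_network g h) d)) (Some (r, q))"

definition feasible :: "'a::finite network \<Rightarrow> 'a node \<Rightarrow> bool" where
  "feasible g y \<longleftrightarrow> (\<exists>\<sigma>. reach_prob g \<sigma> y > 0)"

definition info_set :: "'a::finite network \<Rightarrow> 'a \<Rightarrow> 'a node \<Rightarrow> 'a node set" where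
  "info_set g i y = {y'. feasible g y' \<and> moves_at i y' \<and> observed g i y' = observed g i y}"

text \<open>
  A belief system \<open>\<mu>\<close> gives, for each player i and each node y at which i moves, the probability
  that i assigns to y at her information set containing y.  Information sets are finite, and
  convergence of strategies and beliefs is pointwise.
\<close>

definition consistent :: "'a::finite network \<Rightarrow> 'a profile \<Rightarrow> ('a \<Rightarrow> 'a node \<Rightarrow> real) \<Rightarrow> bool" where
  "consistent g \<sigma> \<mu> \<longleftrightarrow>
     (\<exists>s. (\<forall>k. totally_mixed (s k)) \<and> profile_tendsto s \<sigma> \<and>
        (\<forall>i y. feasible g y \<and> moves_at i y \<longrightarrow>
           (\<lambda>k. reach_prob g (s k) y / (\<Sum>y'\<in>info_set g i y. reach_prob g (s k) y'))
             \<longlonglongrightarrow> \<mu> i y))"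

definition sequentially_rational ::
  "'a::finite network \<Rightarrow> 'a profile \<Rightarrow> ('a \<Rightarrow> 'a node \<Rightarrow> real) \<Rightarrow> bool" where
  "sequentially_rational g \<sigma> \<mu> \<longleftrightarrow>
     (\<forall>i y \<tau>. feasible g y \<and> moves_at i y \<longrightarrow>
        (\<Sum>y'\<in>info_set g i y. \<mu> i y' * node_payoff g (\<sigma>(i := \<tau>)) i y')
          \<le> (\<Sum>y'\<in>info_set g i y. \<mu> i y' * node_payoff g \<sigma> i y'))"

definition bilateral_equilibrium :: "'a::finite network \<Rightarrow> 'a profile \<Rightarrow> bool" where
  "bilateral_equilibrium g \<sigma> \<longleftrightarrow>
     bilaterally_measurable \<sigma> \<and>
     (\<exists>\<mu>. consistent g \<sigma> \<mu> \<and> sequentially_rational g \<sigma> \<mu>)"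

subsection \<open>Stability and constrained efficiency\<close>

definition cooperative_on_path :: "'a::finite network \<Rightarrow> 'a profile \<Rightarrow> bool" where
  "cooperative_on_path g \<sigma> \<longleftrightarrow>
     (\<forall>k. \<forall>h\<in>set_pmf (run g \<sigma> [] k). \<forall>(d, x)\<in>set h.
        (\<forall>e. d e = Keep) \<and> (\<forall>r q a. x = Some (r, q, a) \<longrightarrow> a = Cooperate))"

definition stable :: "'a::finite network \<Rightarrow> bool" where
  "stable g \<longleftrightarrow> network g \<and> (\<exists>\<sigma>. bilateral_equilibrium g \<sigma> \<and> cooperative_on_path g \<sigma>)"

definition utility :: "'a::finite network \<Rightarrow> 'a \<Rightarrow> real" where
  "utility g i = \<alpha> * v * (1 - (1 - p) ^ network_degree g i)
     - (\<Sum>j\<in>neighbors g i. \<alpha> * c * ((1 - (1 - p) ^ network_degree g j) / real (network_degree g j)))"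

text \<open>
  The maximality is among stable networks: the network itself has to satisfy the constraint
  of being stable.
\<close>

definition constrained_efficient :: "'a::finite network \<Rightarrow> bool" where
  "constrained_efficient g \<longleftrightarrow>
     stable g \<and> (\<forall>g'. stable g' \<longrightarrow> (\<forall>i. utility g i \<ge> utility g' i))"

definition cooperation_condition :: "nat \<Rightarrow> bool" where
  "cooperation_condition m \<longleftrightarrow>
     \<delta> * \<alpha> * v * (1 - p) ^ (m - 1) * p - \<delta> * \<alpha> * c * ((1 - (1 - p) ^ m) / real m)
       \<ge> (1 - \<delta>) * (c - \<gamma>)"

definition cooperation_bound :: "nat \<Rightarrow> bool" where
  "cooperation_bound B \<longleftrightarrow>
     (\<forall>m. 1 \<le> m \<and> m \<le> B \<longrightarrow> cooperation_condition m) \<and>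
     (\<forall>m. B < m \<longrightarrow> \<not> cooperation_condition m)"

end

end

(* A favor is worth providing on a link exactly when losing the link would cost more than the favor.
   If a player of maximal degree m has a neighbor, she can refuse the first favor and cut that link in
   the next period; bilateral strategies keep everybody else cooperating, so stability forces the
   cooperation condition at m, and hence m \<le> B.
   Conversely, if all degrees are 0 or B, bilateral grim trigger is an equilibrium.  With uniform
   trembles, a player assigns probability zero to trembles between third parties, as these are never
   needed to explain her observations.  So she believes that each of her remaining neighbors has
   degree B, and her continuation value depends only on the number s of her links without defection.
   It is W(s) / (1 - \<delta>) with W(s) = \<alpha> v (1 - (1 - p)^s) - s \<alpha> c f(B), where f(B) is the probability that
   a player of degree B who needs a favor gets it from a given neighbor.  By the cooperation
   condition W is strictly increasing up to B, with increments that outweigh the gain from defecting.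
   Finally, in a stable network a player of degree d gets at most W(d) \<le> W(B).  Cliques of B + 1 players,
   with all others isolated, give W(B) to any player, even if no B-regular network exists. *)

theory Submission
  imports Defs
begin

text \<open>An arbitrary equilibrium is known only on its path, while the deviator's payoff involves
  histories off it. Bilateral measurability closes this gap: each clean bilateral history has
  positive probability on the path, so cooperation is prescribed after every private history that
  contains it. The refusal is placed in period 0 because that information set is on the path, which
  pins down the belief. The degree must be maximal because the cost of a link is governed by the
  degree of the neighbor, the benefit by the player's own degree, and \<open>favor_share\<close>
  decreases. In the converse, third parties matter because a lost link between them would lower the
  degree of a neighbor and make her requests costlier. That such events get no weight is shown by
  counting trembles: a node with a third-party disturbance shares its information set with a node
  that needs strictly fewer, and reach probabilities are compared as powers of the tremble rate.
  Optimality is then checked at each remaining node by Bellman inequalities that hold against any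
  strategy of the deviator.\<close>

instance link_decision :: finite
proof
  have "(UNIV :: link_decision set) = {Keep, Remove}"
    using link_decision.exhaust by auto
  then show "finite (UNIV :: link_decision set)"
    by (metis finite.emptyI finite.insertI)
qed

instance favor_decision :: finite
proof
  have "(UNIV :: favor_decision set) = {Cooperate, Defect}"
    using favor_decision.exhaust by auto
  then show "finite (UNIV :: favor_decision set)"
    by (metis finite.emptyI finite.insertI)
qed

section \<open>Expectations over finitely supported distributions\<close>

lemma expectation_bind_pmf_finite:
  fixes h :: "'b \<Rightarrow> real"
  assumes "finite (set_pmf M)" "\<And>x. x \<in> set_pmf M \<Longrightarrow> finite (set_pmf (f x))"
  shows "measure_pmf.expectation (bind_pmf M f) h
    = measure_pmf.expectation M (\<lambda>x. measure_pmf.expectation (f x) h)"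
  by (subst pmf_expectation_bind[OF assms(1)]) (use assms in \<open>auto simp: integral_measure_pmf[OF assms(1)]\<close>)

lemma expectation_pmf_mono:
  fixes f g :: "'b \<Rightarrow> real"
  assumes "finite (set_pmf M)" "\<And>x. x \<in> set_pmf M \<Longrightarrow> f x \<le> g x"
  shows "measure_pmf.expectation M f \<le> measure_pmf.expectation M g"
  using assms by (intro integral_mono_AE integrable_measure_pmf_finite) (auto simp: AE_measure_pmf_iff)

lemma expectation_pmf_cong:
  fixes f g :: "'b \<Rightarrow> real"
  assumes "\<And>x. x \<in> set_pmf M \<Longrightarrow> f x = g x"
  shows "measure_pmf.expectation M f = measure_pmf.expectation M g"
  using assms by (intro integral_cong_AE) (auto simp: AE_measure_pmf_iff)

lemma expectation_pmf_le_const: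
  fixes f :: "'b \<Rightarrow> real"
  assumes "finite (set_pmf M)" "\<And>x. x \<in> set_pmf M \<Longrightarrow> f x \<le> C"
  shows "measure_pmf.expectation M f \<le> C"
  using expectation_pmf_mono[of M f "\<lambda>_. C"] assms by simp

text \<open>For outcomes \<open>z\<close> that record the intermediate draw: only one
  \<open>x\<close> can lead to them, so probabilities factor along the game tree.\<close>

lemma pmf_bind_unique:
  assumes "\<And>y. y \<noteq> x \<Longrightarrow> pmf (f y) z = 0"
  shows "pmf (bind_pmf M f) z = pmf M x * pmf (f x) z"
proof -
  have "pmf (bind_pmf M f) z = measure_pmf.expectation M (\<lambda>y. pmf (f y) z)"
    by (rule pmf_bind)
  also have "\<dots> = (\<Sum>y\<in>{x}. pmf (f y) z * pmf M y)"
    using assms by (intro integral_measure_pmf_real) auto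
  finally show ?thesis by simp
qed

lemma pmf_map_inj_outside: "y \<notin> range f \<Longrightarrow> pmf (map_pmf f M) y = 0"
  by (auto simp: pmf_eq_0_set_pmf)

section \<open>Networks\<close>

lemma prune_subset: "prune g d \<subseteq> g"
  by (auto simp: prune_def)

lemma link_in_prune_iff: "{i, j} \<in> prune g d \<longleftrightarrow> {i, j} \<in> g \<and> d (i, j) = Keep \<and> d (j, i) = Keep"
  by (auto simp: prune_def doubleton_eq_iff)

lemma current_network_subset: "current_network g h \<subseteq> g"
  by (induction h) (use prune_subset in fastforce)+

lemma network_mono: "network g \<Longrightarrow> g' \<subseteq> g \<Longrightarrow> network g'"
  by (auto simp: network_def)

lemma network_prune: "network g \<Longrightarrow> network (prune (current_network g h) d)"
  using network_mono prune_subset current_network_subset by blast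

lemma prune_Keep: "prune g (\<lambda>_. Keep) = g"
  by (auto simp: prune_def)

lemma mem_neighbors_iff: "j \<in> neighbors g i \<longleftrightarrow> {i, j} \<in> g"
  by (simp add: neighbors_def)

lemma network_linked_neq: "network g \<Longrightarrow> {i, j} \<in> g \<Longrightarrow> i \<noteq> j"
  by (force simp: network_def)

lemma neighbors_subset: "network g \<Longrightarrow> neighbors g i \<subseteq> UNIV - {i}"
  using network_linked_neq[of g i i] by (auto simp: neighbors_def)

section \<open>Meetings and utilities\<close>

locale favor_market = favor_exchange \<alpha> p \<delta> v c \<gamma>
  for \<alpha> p \<delta> v c \<gamma> :: real +
  fixes players :: "'a::finite itself"
  assumes alpha_pos: "0 < \<alpha>" and card_alpha: "real CARD('a) * \<alpha> \<le> 1"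
    and p_pos: "0 < p" and p_less: "p < 1"
    and delta_pos: "0 < \<delta>" and delta_less: "\<delta> < 1"
    and c_pos: "0 < c" and c_less: "c < v"
    and gamma_nonneg: "0 \<le> \<gamma>" and gamma_less: "\<gamma> < c"
begin

text \<open>The chance that a requester with \<open>d\<close> neighbors is assigned one given
  neighbor: by symmetry, the \<open>d\<close>-th part of the chance that some neighbor is able. It
  is the f of the overview.\<close>

definition favor_share :: "nat \<Rightarrow> real" where
  "favor_share d = (1 - (1 - p) ^ d) / real d"

lemma favor_share_pos: "0 < d \<Longrightarrow> 0 < favor_share d"
  using p_pos p_less by (auto simp: favor_share_def power_less_one_iff)

lemma degree_times_favor_share: "real d * favor_share d = 1 - (1 - p) ^ d"
  by (simp add: favor_share_def)

text \<open>After clearing denominators the claim is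
  \<open>p * d * (1 - p) ^ d \<le> 1 - (1 - p) ^ d\<close>. The right side is \<open>p\<close> times
  a geometric sum of \<open>d\<close> terms, each at least \<open>(1 - p) ^ d\<close>.\<close>

lemma favor_share_Suc: "0 < d \<Longrightarrow> favor_share (Suc d) \<le> favor_share d"
proof -
  assume d: "0 < d"
  have "real d * (1 - p) ^ d = (\<Sum>k<d. (1 - p) ^ d)"
    by simp
  also have "\<dots> \<le> (\<Sum>k<d. (1 - p) ^ k)"
    using p_pos p_less by (intro sum_mono power_decreasing) auto
  finally have "p * (real d * (1 - p) ^ d) \<le> p * (\<Sum>k<d. (1 - p) ^ k)"
    using p_pos by (intro mult_left_mono) auto
  also have "\<dots> = 1 - (1 - p) ^ d"
    using one_diff_power_eq[of "1 - p" d] by simp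
  finally have "real d * (1 - (1 - p) ^ Suc d) \<le> real (Suc d) * (1 - (1 - p) ^ d)"
    by (simp add: algebra_simps)
  then show ?thesis
    using d by (simp add: favor_share_def field_simps)
qed

lemma favor_share_antimono:
  assumes "0 < d" "d \<le> d'"
  shows "favor_share d' \<le> favor_share d"
  using assms(2)
proof (induction d' rule: dec_induct)
  case (step n)
  then show ?case using favor_share_Suc[of n] assms(1) by linarith
qed simp

lemma pmf_requester_Some: "pmf (requester_pmf :: 'a option pmf) (Some r) = \<alpha>"
proof -
  have "0 \<le> real CARD('a) * \<alpha>"
    using alpha_pos by simp
  then show ?thesis
    unfolding requester_pmf_def
    by (subst pmf_bind_unique[where x = True])
       (auto simp: card_alpha pmf_map_inj' split: if_splits)
qed

text \<open>The part of \<open>meeting_pmf\<close> that follows the draw of the requester, isolated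
  so that permutations of the neighbors act on it.\<close>

definition selection_pmf :: "'a set \<Rightarrow> 'a \<Rightarrow> 'a option pmf" where
  "selection_pmf N r = do { able \<leftarrow> Pi_pmf (UNIV - {r}) False (\<lambda>_. bernoulli_pmf p);
     let A = {q \<in> N. able q} in
     if A = {} then return_pmf None else map_pmf Some (pmf_of_set A) }"

lemma meeting_pmf_selection:
  "meeting_pmf (g :: 'a network) = do { x \<leftarrow> requester_pmf;
     case x of None \<Rightarrow> return_pmf None
     | Some r \<Rightarrow> map_pmf (map_option (Pair r)) (selection_pmf (neighbors g r) r) }"
  unfolding meeting_pmf_def selection_pmf_def Let_def
  by (intro bind_pmf_cong refl)
     (auto simp: map_bind_pmf pmf.map_comp o_def intro!: bind_pmf_cong split: option.splits)

lemma pmf_selection_None: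
  assumes "N \<subseteq> UNIV - {r}"
  shows "pmf (selection_pmf N r) None = (1 - p) ^ card N"
proof -
  let ?P = "Pi_pmf (UNIV - {r}) False (\<lambda>_. bernoulli_pmf p)"
  let ?B = "\<lambda>x. if x \<in> N then {False} else UNIV"
  have "pmf (selection_pmf N r) None = measure_pmf.expectation ?P (indicator (Pi (UNIV - {r}) ?B))"
    unfolding selection_pmf_def pmf_bind
    using assms by (intro Bochner_Integration.integral_cong) (auto simp: Let_def pmf_map_inj_outside indicator_def Pi_def)
  also have "\<dots> = measure_pmf.prob ?P (Pi (UNIV - {r}) ?B)"
    by simp
  also have "\<dots> = (\<Prod>x\<in>UNIV - {r}. measure_pmf.prob (bernoulli_pmf p) (?B x))"
    by (subst measure_Pi_pmf_Pi) auto
  also have "\<dots> = (\<Prod>x\<in>UNIV - {r}. if x \<in> N then 1 - p else 1)"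
    using p_pos p_less by (intro prod.cong) (auto simp: measure_pmf_single)
  also have "\<dots> = (1 - p) ^ card N"
    using assms by (simp add: prod.If_cases Int_absorb1)
  finally show ?thesis .
qed

lemma pmf_selection_Some_outside:
  assumes "q \<notin> N"
  shows "pmf (selection_pmf N r) (Some q) = 0"
proof -
  have "Some q \<notin> set_pmf (selection_pmf N r)"
    using assms by (auto simp: selection_pmf_def Let_def split: if_splits)
  then show ?thesis by (simp add: set_pmf_iff)
qed

text \<open>Abilities are independent and identically distributed, so swapping \<open>q\<close> and
  \<open>q'\<close> preserves their joint law and the number of able neighbors. This exchangeability
  replaces computing the mean of the reciprocal of that number.\<close>

lemma pmf_selection_Some_sym:
  assumes "N \<subseteq> UNIV - {r}" "q \<in> N" "q' \<in> N"
  shows "pmf (selection_pmf N r) (Some q) = pmf (selection_pmf N r) (Some q')"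
proof -
  let ?P = "Pi_pmf (UNIV - {r}) False (\<lambda>_. bernoulli_pmf p)"
  let ?t = "Transposition.transpose q q'"
  let ?F = "\<lambda>q able. pmf (let A = {q \<in> N. able q} in
     if A = {} then return_pmf None else map_pmf Some (pmf_of_set A)) (Some q)"
  have F: "?F q able = (if able q \<and> q \<in> N then 1 / real (card {q \<in> N. able q}) else 0)" for q able
    by (auto simp: Let_def pmf_map_inj' indicator_def)
  have "pmf (selection_pmf N r) (Some q) = measure_pmf.expectation ?P (?F q)"
    unfolding selection_pmf_def pmf_bind ..
  also have "?P = map_pmf (\<lambda>g. g \<circ> ?t) ?P"
    using assms by (intro Pi_pmf_bij_betw) (auto simp: Transposition.transpose_def bij_betw_def inj_on_def image_def)
  also have "measure_pmf.expectation \<dots> (?F q) = measure_pmf.expectation ?P (\<lambda>able. ?F q (able \<circ> ?t))"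
    by (simp add: o_def)
  also have "(\<lambda>able. ?F q (able \<circ> ?t)) = ?F q'"
  proof
    fix able :: "'a \<Rightarrow> bool"
    have "?t ` {x \<in> N. able x} = {x \<in> N. (able \<circ> ?t) x}"
    proof safe
      fix x assume x: "x \<in> N" "(able \<circ> ?t) x"
      then have "?t x \<in> {x \<in> N. able x}"
        using assms by (auto simp: Transposition.transpose_def)
      then show "x \<in> ?t ` {x \<in> N. able x}"
        by (metis image_eqI transpose_involutory)
    qed (use assms in \<open>auto simp: Transposition.transpose_def\<close>)
    then have "card {x \<in> N. (able \<circ> ?t) x} = card {x \<in> N. able x}"
      using card_image[OF inj_on_subset[OF inj_transpose subset_UNIV]] by metis
    then show "?F q (able \<circ> ?t) = ?F q' able"
      using assms unfolding F by simp
  qed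
  also have "measure_pmf.expectation ?P (?F q') = pmf (selection_pmf N r) (Some q')"
    unfolding selection_pmf_def pmf_bind ..
  finally show ?thesis .
qed

text \<open>The neighbors share equally the mass left over by \<open>None\<close>.\<close>

lemma pmf_selection_Some:
  assumes "N \<subseteq> UNIV - {r}" "q \<in> N"
  shows "pmf (selection_pmf N r) (Some q) = favor_share (card N)"
proof -
  have "1 = (\<Sum>x\<in>UNIV. pmf (selection_pmf N r) x)"
    by (rule sum_pmf_eq_1[symmetric]) auto
  also have "\<dots> = pmf (selection_pmf N r) None + (\<Sum>x\<in>UNIV. pmf (selection_pmf N r) (Some x))"
    by (simp add: UNIV_option_conv sum.reindex)
  also have "(\<Sum>x\<in>UNIV. pmf (selection_pmf N r) (Some x)) = (\<Sum>x\<in>N. pmf (selection_pmf N r) (Some x))"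
    by (rule sum.mono_neutral_right) (auto simp: pmf_selection_Some_outside)
  also have "\<dots> = real (card N) * pmf (selection_pmf N r) (Some q)"
    by (subst sum.cong[OF refl pmf_selection_Some_sym[OF assms(1) _ assms(2)]]) simp_all
  also have "pmf (selection_pmf N r) None = (1 - p) ^ card N"
    using assms by (intro pmf_selection_None)
  finally have "real (card N) * pmf (selection_pmf N r) (Some q) = 1 - (1 - p) ^ card N"
    by simp
  moreover have "card N > 0"
    using assms by (metis card_gt_0_iff empty_iff finite_code)
  ultimately show ?thesis
    by (auto simp: favor_share_def eq_divide_eq mult.commute)
qed

lemma pmf_meeting_Some:
  assumes "network (g :: 'a network)"
  shows "pmf (meeting_pmf g) (Some (r, q))
    = (if {r, q} \<in> g then \<alpha> * favor_share (network_degree g r) else 0)"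
proof -
  have inj: "inj (map_option (Pair r))"
    by (rule option.inj_map) (simp add: inj_def)
  have "pmf (map_pmf (map_option (Pair r')) M) (Some (r, q)) = 0" if "r' \<noteq> r" for r' and M :: "'a option pmf"
    using that by (intro pmf_map_inj_outside) (auto dest!: sym[of "Some _"])
  then have other: "pmf (case x of None \<Rightarrow> return_pmf None
      | Some r' \<Rightarrow> map_pmf (map_option (Pair r')) (selection_pmf (neighbors g r') r')) (Some (r, q)) = 0"
    if "x \<noteq> Some r" for x
    using that by (cases x) auto
  have "pmf (meeting_pmf g) (Some (r, q))
      = \<alpha> * pmf (map_pmf (map_option (Pair r)) (selection_pmf (neighbors g r) r)) (map_option (Pair r) (Some q))"
    unfolding meeting_pmf_selection
    by (subst pmf_bind_unique[where x = "Some r"]) (simp_all add: pmf_requester_Some other)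
  also have "\<dots> = \<alpha> * pmf (selection_pmf (neighbors g r) r) (Some q)"
    by (subst pmf_map_inj'[OF inj]) simp
  finally show ?thesis
    using pmf_selection_Some[OF neighbors_subset[OF assms]] pmf_selection_Some_outside
    by (auto simp: network_degree_def mem_neighbors_iff)
qed

lemma set_pmf_meeting_linked:
  assumes "network (g :: 'a network)" "Some (r, q) \<in> set_pmf (meeting_pmf g)"
  shows "{r, q} \<in> g"
  using assms by (auto simp: set_pmf_iff pmf_meeting_Some split: if_splits)

lemma network_degree_pos: "{r, q} \<in> g \<Longrightarrow> 0 < network_degree (g :: 'a network) r"
  by (metis card_gt_0_iff empty_iff finite_code mem_neighbors_iff network_degree_def)

lemma pmf_meeting_Some_pos:
  assumes "network (g :: 'a network)" "{r, q} \<in> g"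
  shows "0 < pmf (meeting_pmf g) (Some (r, q))"
  using assms network_degree_pos[of r q g] alpha_pos favor_share_pos by (simp add: pmf_meeting_Some)

text \<open>If \<open>CARD('a) * \<alpha> = 1\<close>, somebody requests a favor in every period, and then the absence of
  able providers is needed.\<close>

lemma pmf_meeting_None_pos:
  assumes "network (g :: 'a network)"
  shows "0 < pmf (meeting_pmf g) None"
proof -
  obtain r :: 'a where True by simp
  have "0 < pmf (requester_pmf :: 'a option pmf) (Some r)"
    using alpha_pos by (simp add: pmf_requester_Some)
  then have r: "Some r \<in> set_pmf (requester_pmf :: 'a option pmf)"
    by (simp add: pmf_positive_iff)
  have "0 < pmf (selection_pmf (neighbors g r) r) None"
    using p_less by (simp add: pmf_selection_None[OF neighbors_subset[OF assms]])
  then have "None \<in> set_pmf (selection_pmf (neighbors g r) r)"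
    by (simp add: pmf_positive_iff)
  then have "None \<in> set_pmf (meeting_pmf g)"
    unfolding meeting_pmf_selection using r by (force split: option.splits)
  then show ?thesis by (simp add: pmf_positive_iff)
qed

text \<open>The benchmark in which the selected provider does the favor; actual play is compared
  with it.\<close>

definition meeting_payoff :: "'a \<Rightarrow> ('a \<times> 'a) option \<Rightarrow> real" where
  "meeting_payoff i m = (case m of None \<Rightarrow> 0
     | Some (r, q) \<Rightarrow> if i = r then v else if i = q then - c else 0)"

text \<open>Ties the closed formula for \<open>utility\<close> to the stage game: \<open>i\<close>
  gains \<open>v\<close> when any of her neighbors is selected for her, and pays \<open>c\<close>
  when a neighbor \<open>j\<close> selects her, which depends on the degree of
  \<open>j\<close>.\<close>

lemma expectation_meeting_payoff:
  assumes net: "network (g :: 'a network)"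
  shows "measure_pmf.expectation (meeting_pmf g) (meeting_payoff i) = utility g i"
proof -
  let ?m = "\<lambda>r q. pmf (meeting_pmf g) (Some (r, q))"
  have loop: "{i, i} \<notin> g"
    using network_linked_neq[OF net, of i i] by blast
  have "measure_pmf.expectation (meeting_pmf g) (meeting_payoff i)
      = (\<Sum>m\<in>UNIV. meeting_payoff i m * pmf (meeting_pmf g) m)"
    by (intro integral_measure_pmf_real) auto
  also have "\<dots> = (\<Sum>(r, q)\<in>UNIV. meeting_payoff i (Some (r, q)) * ?m r q)"
    by (simp add: UNIV_option_conv sum.reindex case_prod_unfold meeting_payoff_def[of i None])
  also have "\<dots> = (\<Sum>r\<in>UNIV. \<Sum>q\<in>UNIV. meeting_payoff i (Some (r, q)) * ?m r q)"
    by (simp add: sum.cartesian_product flip: UNIV_Times_UNIV)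
  also have "\<dots> = (\<Sum>r\<in>UNIV. (if r = i then v * (\<Sum>q\<in>UNIV. ?m i q) else 0) - c * ?m r i)"
  proof (rule sum.cong[OF refl])
    fix r
    show "(\<Sum>q\<in>UNIV. meeting_payoff i (Some (r, q)) * ?m r q)
        = (if r = i then v * (\<Sum>q\<in>UNIV. ?m i q) else 0) - c * ?m r i"
    proof (cases "r = i")
      \<comment> \<open>Without loops the coefficient of \<open>- c\<close> vanishes for
        \<open>r = i\<close>, so both cases can share one formula.\<close>
      case True
      then have "?m r i = 0"
        using loop by (simp add: pmf_meeting_Some[OF net])
      then show ?thesis
        using True by (simp add: meeting_payoff_def sum_distrib_left)
    next
      case False
      then have "(\<Sum>q\<in>UNIV. meeting_payoff i (Some (r, q)) * ?m r q) = (\<Sum>q\<in>UNIV. if q = i then - c * ?m r i else 0)"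
        by (intro sum.cong) (auto simp: meeting_payoff_def)
      then show ?thesis
        using False by (simp add: sum.delta)
    qed
  qed
  also have "\<dots> = v * (\<Sum>q\<in>UNIV. ?m i q) - c * (\<Sum>r\<in>UNIV. ?m r i)"
    by (simp add: sum_subtractf sum.delta' sum_distrib_left)
  also have "(\<Sum>q\<in>UNIV. ?m i q) = (\<Sum>q\<in>neighbors g i. \<alpha> * favor_share (network_degree g i))"
    using net by (intro sum.mono_neutral_cong_right) (auto simp: pmf_meeting_Some mem_neighbors_iff)
  also have "\<dots> = \<alpha> * (real (network_degree g i) * favor_share (network_degree g i))"
    by (simp add: network_degree_def)
  also have "real (network_degree g i) * favor_share (network_degree g i) = 1 - (1 - p) ^ network_degree g i"
    by (rule degree_times_favor_share)
  also have "(\<Sum>r\<in>UNIV. ?m r i) = (\<Sum>j\<in>neighbors g i. \<alpha> * favor_share (network_degree g j))"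
    using net by (intro sum.mono_neutral_cong_right)
      (auto simp: pmf_meeting_Some mem_neighbors_iff insert_commute)
  finally show ?thesis
    unfolding utility_def favor_share_def[symmetric] by (simp add: sum_distrib_left ac_simps)
qed

end

section \<open>Histories\<close>

lemma finite_histories: "finite {h :: 'a::finite history. length h = n}"
  using finite_lists_length_eq[of "UNIV :: 'a period set" n] by simp

definition clean :: "'a \<Rightarrow> 'a \<Rightarrow> 'a private_history \<Rightarrow> bool" where
  "clean i j x \<longleftrightarrow> (\<forall>r q a. Some (r, q, a) \<in> set (bilateral_history i j x) \<longrightarrow> a = Cooperate)"

definition clean_pair :: "'a \<Rightarrow> 'a \<Rightarrow> 'a history \<Rightarrow> bool" where
  "clean_pair i j h \<longleftrightarrow> 
    (\<forall>x\<in>set h. \<forall>r q a. snd x = Some (r, q, a) \<and> {r, q} = {i, j} \<longrightarrow> a = Cooperate)"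

lemma clean_pair_Nil [simp]: "clean_pair i j []"
  by (simp add: clean_pair_def)

lemma clean_pair_Cons: "clean_pair i j (x # h) \<longleftrightarrow>
    (\<forall>r q a. snd x = Some (r, q, a) \<and> {r, q} = {i, j} \<longrightarrow> a = Cooperate) \<and> clean_pair i j h"
  by (simp add: clean_pair_def)

lemma clean_pair_sym: "clean_pair i j h \<longleftrightarrow> clean_pair j i h"
  by (simp add: clean_pair_def insert_commute)

lemma bilateral_history_Cons: "bilateral_history i j (y # x) =
    (case snd y of None \<Rightarrow> None | Some (r, q, a) \<Rightarrow> if {r, q} = {i, j} then Some (r, q, a) else None)
      # bilateral_history i j x"
  by (cases y) (simp add: bilateral_history_def)

lemma clean_Cons: "clean i j (y # x) \<longleftrightarrow>
    (\<forall>r q a. snd y = Some (r, q, a) \<and> {r, q} = {i, j} \<longrightarrow> a = Cooperate) \<and> clean i j x"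
  unfolding clean_def bilateral_history_Cons by (auto split: option.splits)

text \<open>A player witnesses every play on her own links. As \<open>clean_pair\<close> is
  symmetric, both ends of a link always agree on its state, so grim trigger is coordinated.\<close>

lemma clean_private_history [simp]: "clean i j (private_history g i h) \<longleftrightarrow> clean_pair i j h"
proof (induction h)
  case Nil
  then show ?case by (simp add: clean_def bilateral_history_def)
next
  case (Cons x h)
  then show ?case
    by (cases x) (auto simp: clean_Cons clean_pair_Cons own_play_def doubleton_eq_iff split: option.splits)
qed

text \<open>The interface shared by both directions: players in any equilibrium supporting a stable
  network satisfy it, and so does grim trigger. Behavior on links with a past defection is left
  open.\<close>

definition cooperates_if_clean :: "'a network \<Rightarrow> 'a profile \<Rightarrow> 'a \<Rightarrow> bool" where
  "cooperates_if_clean g \<sigma> k \<longleftrightarrow> (\<forall>l x. {k, l} \<in> g \<and> clean k l x \<longrightarrow>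
     link_choice (\<sigma> k) x l = return_pmf Keep \<and> (\<forall>y. favor_choice (\<sigma> k) x y l = return_pmf Cooperate))"

context favor_market
begin

lemma set_link_pmf: "d \<in> set_pmf (link_pmf (g :: 'a network) \<sigma> h) \<longleftrightarrow>
    (\<forall>k l. if {k, l} \<in> current_network g h
           then d (k, l) \<in> set_pmf (link_choice (\<sigma> k) (private_history g k h) l) else d (k, l) = Keep)"
  unfolding link_pmf_def by (subst set_Pi_pmf) (auto simp: PiE_dflt_def)

lemma set_period_pmf:
  assumes "network (g :: 'a network)" "x \<in> set_pmf (period_pmf g \<sigma> h)"
  obtains d where "d \<in> set_pmf (link_pmf g \<sigma> h)" "x = (d, None)"
  | d r q a where "d \<in> set_pmf (link_pmf g \<sigma> h)" "x = (d, Some (r, q, a))"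
      "{r, q} \<in> prune (current_network g h) d" "a \<in> set_pmf (favor_pmf g \<sigma> h d r q)"
proof -
  from assms(2) obtain d m where d: "d \<in> set_pmf (link_pmf g \<sigma> h)"
    and m: "m \<in> set_pmf (meeting_pmf (prune (current_network g h) d))"
    and x: "x \<in> set_pmf (case m of None \<Rightarrow> return_pmf (d, None)
          | Some (r, q) \<Rightarrow> map_pmf (\<lambda>a. (d, Some (r, q, a))) (favor_pmf g \<sigma> h d r q))"
    unfolding period_pmf_def by auto
  show thesis
  proof (cases m)
    case None
    then show ?thesis using d x that(1) by auto
  next
    case (Some rq)
    then show ?thesis
      using d m x that(2) set_pmf_meeting_linked[OF network_prune[OF assms(1)]] by (cases rq) auto
  qed
qed

lemma set_period_pmf_None:
  assumes "network (g :: 'a network)" "d \<in> set_pmf (link_pmf g \<sigma> h)"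
  shows "(d, None) \<in> set_pmf (period_pmf g \<sigma> h)"
proof -
  have "None \<in> set_pmf (meeting_pmf (prune (current_network g h) d))"
    using pmf_meeting_None_pos[OF network_prune[OF assms(1)]] by (simp add: pmf_positive_iff)
  then show ?thesis
    using assms(2) unfolding period_pmf_def by (fastforce split: option.splits)
qed

lemma set_period_pmf_Some:
  assumes "network (g :: 'a network)" "d \<in> set_pmf (link_pmf g \<sigma> h)"
    and "{r, q} \<in> prune (current_network g h) d" "a \<in> set_pmf (favor_pmf g \<sigma> h d r q)"
  shows "(d, Some (r, q, a)) \<in> set_pmf (period_pmf g \<sigma> h)"
proof -
  have "Some (r, q) \<in> set_pmf (meeting_pmf (prune (current_network g h) d))"
    using pmf_meeting_Some_pos[OF network_prune[OF assms(1)] assms(3)] by (simp add: pmf_positive_iff)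
  then show ?thesis
    using assms(2,4) unfolding period_pmf_def by (fastforce split: option.splits)
qed

lemma link_profile_Keep:
  assumes "d \<in> set_pmf (link_pmf (g :: 'a network) \<sigma> h)" "cooperates_if_clean g \<sigma> k" "clean_pair k l h"
  shows "d (k, l) = Keep"
proof (cases "{k, l} \<in> current_network g h")
  case True
  then have "{k, l} \<in> g"
    using current_network_subset by blast
  then have "link_choice (\<sigma> k) (private_history g k h) l = return_pmf Keep"
    using assms(2,3) by (simp add: cooperates_if_clean_def)
  moreover have "d (k, l) \<in> set_pmf (link_choice (\<sigma> k) (private_history g k h) l)"
    using assms(1) True unfolding set_link_pmf by meson
  ultimately show ?thesis by simp
next
  case False
  then show ?thesis using assms(1) unfolding set_link_pmf by meson
qed

lemma favor_pmf_Cooperate: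
  assumes "cooperates_if_clean (g :: 'a network) \<sigma> q" "{r, q} \<in> g" "clean_pair r q h"
  shows "favor_pmf g \<sigma> h d r q = return_pmf Cooperate"
  using assms unfolding cooperates_if_clean_def favor_pmf_def
  by (metis clean_private_history clean_pair_sym insert_commute)

section \<open>Discounted payoffs\<close>

lemma length_run: "h' \<in> set_pmf (run (g :: 'a network) \<sigma> h k) \<Longrightarrow> length h' = length h + k"
  by (induction k arbitrary: h') auto

lemma finite_set_run: "finite (set_pmf (run (g :: 'a network) \<sigma> h k))"
  by (rule finite_subset[OF _ finite_histories[of "length h + k"]]) (auto dest: length_run)

lemma expectation_run_Suc:
  fixes F :: "'a history \<Rightarrow> real"
  shows "measure_pmf.expectation (run g \<sigma> h (Suc k)) F
    = measure_pmf.expectation (run g \<sigma> h k) (\<lambda>h'. measure_pmf.expectation (period_pmf g \<sigma> h') (\<lambda>x. F (x # h')))"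
  by (simp add: expectation_bind_pmf_finite finite_set_run)

lemma run_invariant:
  assumes "P h" "\<And>h x. P h \<Longrightarrow> x \<in> set_pmf (period_pmf (g :: 'a network) \<sigma> h) \<Longrightarrow> P (x # h)"
    and "h' \<in> set_pmf (run g \<sigma> h k)"
  shows "P h'"
  using assms(3) by (induction k arbitrary: h') (auto simp: assms(1,2))

text \<open>The type of periods is finite, so \<open>f\<close> is bounded and a geometric series
  dominates.\<close>

lemma summable_discounted:
  fixes f :: "'a period \<Rightarrow> real"
  shows "summable (\<lambda>k. \<delta> ^ k * measure_pmf.expectation (run g \<sigma> h (Suc k)) (\<lambda>h'. f (hd h')))"
proof (rule summable_comparison_test)
  define C where "C = Max (range (\<lambda>x. \<bar>f x\<bar>))"
  have C: "\<bar>f x\<bar> \<le> C" for x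
    unfolding C_def by (intro Max_ge) auto
  have "\<bar>measure_pmf.expectation (run g \<sigma> h (Suc k)) (\<lambda>h'. f (hd h'))\<bar> \<le> C" for k
  proof -
    have "f x \<le> C" "- C \<le> f x" for x
      using C[of x] by linarith+
    then show ?thesis
      using expectation_pmf_mono[OF finite_set_run, of g \<sigma> h "Suc k" "\<lambda>_. - C" "\<lambda>h'. f (hd h')"]
        expectation_pmf_le_const[OF finite_set_run, of g \<sigma> h "Suc k" "\<lambda>h'. f (hd h')" C]
      by (simp add: abs_le_iff minus_le_iff del: run.simps)
  qed
  then show "\<exists>N. \<forall>k\<ge>N. norm (\<delta> ^ k * measure_pmf.expectation (run g \<sigma> h (Suc k)) (\<lambda>h'. f (hd h'))) \<le> \<delta> ^ k * C"
    using delta_pos by (auto simp: abs_mult simp del: run.simps intro!: mult_left_mono exI[of _ 0])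
  show "summable (\<lambda>k. \<delta> ^ k * C)"
    using delta_pos delta_less by (intro summable_mult2 summable_geometric) auto
qed

text \<open>A verification argument: on the invariant set \<open>P\<close>, the Bellman inequality
  telescopes along the run, and the discounted remainder vanishes because \<open>V\<close> is
  bounded. It controls deviations in infinitely many periods at once.\<close>

lemma discounted_sum_le:
  fixes f :: "'a period \<Rightarrow> real"
  assumes P: "P h" "\<And>h x. P h \<Longrightarrow> x \<in> set_pmf (period_pmf g \<sigma> h) \<Longrightarrow> P (x # h)"
    and bellman: "\<And>h. P h \<Longrightarrow> measure_pmf.expectation (period_pmf g \<sigma> h) (\<lambda>x. f x + \<delta> * V (x # h)) \<le> V h"
    and bounded: "\<And>h. \<bar>V h\<bar> \<le> M"
  shows "(\<Sum>k. \<delta> ^ k * measure_pmf.expectation (run g \<sigma> h (Suc k)) (\<lambda>h'. f (hd h'))) \<le> V h"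
proof -
  let ?E = "\<lambda>k. measure_pmf.expectation (run g \<sigma> h k)"
  let ?s = "\<lambda>k. \<delta> ^ k * ?E (Suc k) (\<lambda>h'. f (hd h'))"
  have step: "?E (Suc n) (\<lambda>h'. f (hd h')) + \<delta> * ?E (Suc n) V \<le> ?E n V" for n
  proof -
    have "?E (Suc n) (\<lambda>h'. f (hd h')) + \<delta> * ?E (Suc n) V = ?E (Suc n) (\<lambda>h'. f (hd h') + \<delta> * V h')"
      by (simp add: integrable_measure_pmf_finite[OF finite_set_run] del: run.simps)
    also have "\<dots> = ?E n (\<lambda>h'. measure_pmf.expectation (period_pmf g \<sigma> h') (\<lambda>x. f x + \<delta> * V (x # h')))"
      by (simp add: expectation_run_Suc del: run.simps)
    also have "\<dots> \<le> ?E n V"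
      using run_invariant[of P, OF P] bellman by (intro expectation_pmf_mono finite_set_run) auto
    finally show ?thesis .
  qed
  have partial: "(\<Sum>k<n. ?s k) + \<delta> ^ n * ?E n V \<le> V h" for n
  proof (induction n)
    case (Suc n)
    have "\<delta> ^ n * (?E (Suc n) (\<lambda>h'. f (hd h')) + \<delta> * ?E (Suc n) V) \<le> \<delta> ^ n * ?E n V"
      using step[of n] delta_pos by (intro mult_left_mono) auto
    then show ?case using Suc by (simp add: algebra_simps del: run.simps)
  qed simp
  have "(\<Sum>k<n. ?s k) \<le> V h + \<delta> ^ n * M" for n
  proof -
    have "- V h \<le> M" for h
      using bounded[of h] by linarith
    then have "?E n (\<lambda>h. - V h) \<le> M"
      by (intro expectation_pmf_le_const finite_set_run) auto
    then have "\<delta> ^ n * - ?E n V \<le> \<delta> ^ n * M"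
      using delta_pos by (intro mult_left_mono) auto
    then show ?thesis using partial[of n] by simp
  qed
  moreover have "(\<lambda>n. V h + \<delta> ^ n * M) \<longlonglongrightarrow> V h + 0 * M"
    using delta_pos delta_less by (intro tendsto_intros LIMSEQ_realpow_zero) auto
  ultimately show ?thesis
    using LIMSEQ_le[OF summable_LIMSEQ[OF summable_discounted[of g \<sigma> h f]]] by (auto simp del: run.simps)
qed

lemma discounted_payoff_le:
  assumes "P h" "\<And>h x. P h \<Longrightarrow> x \<in> set_pmf (period_pmf (g :: 'a network) \<sigma> h) \<Longrightarrow> P (x # h)"
    and "\<And>h. P h \<Longrightarrow>
      measure_pmf.expectation (period_pmf g \<sigma> h) (\<lambda>x. payoff i x + \<delta> * V (x # h)) \<le> V h"
    and "\<And>h. \<bar>V h\<bar> \<le> M"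
  shows "discounted_payoff g \<sigma> i h \<le> V h"
  unfolding discounted_payoff_def by (rule discounted_sum_le[of P, OF assms])

lemma discounted_payoff_ge:
  assumes P: "P h" "\<And>h x. P h \<Longrightarrow> x \<in> set_pmf (period_pmf (g :: 'a network) \<sigma> h) \<Longrightarrow> P (x # h)"
    and bellman: "\<And>h. P h \<Longrightarrow>
      measure_pmf.expectation (period_pmf g \<sigma> h) (\<lambda>x. payoff i x + \<delta> * V (x # h)) \<ge> V h"
    and bounded: "\<And>h. \<bar>V h\<bar> \<le> M"
  shows "discounted_payoff g \<sigma> i h \<ge> V h"
proof -
  have "(\<Sum>k. \<delta> ^ k * measure_pmf.expectation (run g \<sigma> h (Suc k)) (\<lambda>h'. - payoff i (hd h'))) \<le> - V h"
  proof (rule discounted_sum_le[of P _ _ _ _ "\<lambda>h. - V h", OF P])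
    fix h assume "P h"
    then have "- measure_pmf.expectation (period_pmf g \<sigma> h) (\<lambda>x. payoff i x + \<delta> * V (x # h)) \<le> - V h"
      using bellman by simp
    then show "measure_pmf.expectation (period_pmf g \<sigma> h) (\<lambda>x. - payoff i x + \<delta> * - V (x # h)) \<le> - V h"
      by (subst (asm) integral_minus[symmetric]) simp
  qed (use bounded in auto)
  moreover have "(\<Sum>k. \<delta> ^ k * measure_pmf.expectation (run g \<sigma> h (Suc k)) (\<lambda>h'. - payoff i (hd h')))
      = - discounted_payoff g \<sigma> i h"
    using suminf_minus[OF summable_discounted[of g \<sigma> h "payoff i"]]
    by (simp add: discounted_payoff_def del: run.simps)
  ultimately show ?thesis by simp
qed

lemma expectation_period:
  fixes F :: "'a period \<Rightarrow> real"
  shows "measure_pmf.expectation (period_pmf g \<sigma> h) F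
    = measure_pmf.expectation (link_pmf g \<sigma> h) (\<lambda>d.
        measure_pmf.expectation (meeting_pmf (prune (current_network g h) d)) (\<lambda>m.
          case m of None \<Rightarrow> F (d, None)
          | Some (r, q) \<Rightarrow> measure_pmf.expectation (favor_pmf g \<sigma> h d r q) (\<lambda>a. F (d, Some (r, q, a)))))"
  unfolding period_pmf_def
  by (auto simp: expectation_bind_pmf_finite intro!: Bochner_Integration.integral_cong split: option.splits)

lemma meeting_expectation_plus_const:
  assumes "network (N :: 'a network)"
  shows "measure_pmf.expectation (meeting_pmf N) (\<lambda>m. K + meeting_payoff i m) = K + utility N i"
  using expectation_meeting_payoff[OF assms] by (simp add: integrable_measure_pmf_finite)

text \<open>\<open>K d\<close> stands for the discounted continuation after link profile
  \<open>d\<close> if no favor is refused. A refusal may change payoff and continuation, but their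
  total must not exceed that of a provided favor; averaging over meetings then yields
  \<open>K d\<close> plus \<open>utility\<close>.\<close>

lemma expectation_period_le:
  fixes F :: "'a period \<Rightarrow> real"
  assumes net: "network g"
    and None: "\<And>d. d \<in> set_pmf (link_pmf g \<sigma> h) \<Longrightarrow> F (d, None) \<le> K d"
    and Some: "\<And>d r q a. d \<in> set_pmf (link_pmf g \<sigma> h) \<Longrightarrow> {r, q} \<in> prune (current_network g h) d \<Longrightarrow>
      a \<in> set_pmf (favor_pmf g \<sigma> h d r q) \<Longrightarrow> F (d, Some (r, q, a)) \<le> K d + meeting_payoff i (Some (r, q))"
    and total: "\<And>d. d \<in> set_pmf (link_pmf g \<sigma> h) \<Longrightarrow> K d + utility (prune (current_network g h) d) i \<le> U"
  shows "measure_pmf.expectation (period_pmf g \<sigma> h) F \<le> U"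
  unfolding expectation_period
proof (rule expectation_pmf_le_const)
  fix d assume d: "d \<in> set_pmf (link_pmf g \<sigma> h)"
  let ?N = "prune (current_network g h) d"
  have "measure_pmf.expectation (meeting_pmf ?N) (\<lambda>m. case m of None \<Rightarrow> F (d, None)
      | Some (r, q) \<Rightarrow> measure_pmf.expectation (favor_pmf g \<sigma> h d r q) (\<lambda>a. F (d, Some (r, q, a))))
    \<le> measure_pmf.expectation (meeting_pmf ?N) (\<lambda>m. K d + meeting_payoff i m)"
    using None[OF d] Some[OF d] set_pmf_meeting_linked[OF network_prune[OF net]]
    by (intro expectation_pmf_mono)
       (auto simp: meeting_payoff_def[of i None] split: option.splits intro!: expectation_pmf_le_const)
  also have "\<dots> \<le> U"
    using total[OF d] by (simp add: meeting_expectation_plus_const network_prune net)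
  finally show "measure_pmf.expectation (meeting_pmf ?N) (\<lambda>m. case m of None \<Rightarrow> F (d, None)
      | Some (r, q) \<Rightarrow> measure_pmf.expectation (favor_pmf g \<sigma> h d r q) (\<lambda>a. F (d, Some (r, q, a)))) \<le> U" .
qed simp

lemma expectation_period_eq:
  fixes F :: "'a period \<Rightarrow> real"
  assumes net: "network g"
    and None: "\<And>d. d \<in> set_pmf (link_pmf g \<sigma> h) \<Longrightarrow> F (d, None) = K d"
    and Some: "\<And>d r q a. d \<in> set_pmf (link_pmf g \<sigma> h) \<Longrightarrow> {r, q} \<in> prune (current_network g h) d \<Longrightarrow>
      a \<in> set_pmf (favor_pmf g \<sigma> h d r q) \<Longrightarrow> F (d, Some (r, q, a)) = K d + meeting_payoff i (Some (r, q))"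
    and total: "\<And>d. d \<in> set_pmf (link_pmf g \<sigma> h) \<Longrightarrow> K d + utility (prune (current_network g h) d) i = U"
  shows "measure_pmf.expectation (period_pmf g \<sigma> h) F = U"
proof -
  have "measure_pmf.expectation (period_pmf g \<sigma> h) F = measure_pmf.expectation (link_pmf g \<sigma> h) (\<lambda>_. U)"
    unfolding expectation_period
  proof (rule expectation_pmf_cong)
    fix d assume d: "d \<in> set_pmf (link_pmf g \<sigma> h)"
    let ?N = "prune (current_network g h) d"
    have "measure_pmf.expectation (favor_pmf g \<sigma> h d r q) (\<lambda>a. F (d, Some (r, q, a)))
        = K d + meeting_payoff i (Some (r, q))" if "{r, q} \<in> ?N" for r q
      using expectation_pmf_cong[of "favor_pmf g \<sigma> h d r q", OF Some[OF d that]] by simp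
    then have "measure_pmf.expectation (meeting_pmf ?N) (\<lambda>m. case m of None \<Rightarrow> F (d, None)
        | Some (r, q) \<Rightarrow> measure_pmf.expectation (favor_pmf g \<sigma> h d r q) (\<lambda>a. F (d, Some (r, q, a))))
      = measure_pmf.expectation (meeting_pmf ?N) (\<lambda>m. K d + meeting_payoff i m)"
      using None[OF d] set_pmf_meeting_linked[OF network_prune[OF net]]
      by (intro expectation_pmf_cong) (auto simp: meeting_payoff_def[of i None] split: option.splits)
    also have "\<dots> = U"
      using total[OF d] by (simp add: meeting_expectation_plus_const network_prune net)
    finally show "measure_pmf.expectation (meeting_pmf ?N) (\<lambda>m. case m of None \<Rightarrow> F (d, None)
        | Some (r, q) \<Rightarrow> measure_pmf.expectation (favor_pmf g \<sigma> h d r q) (\<lambda>a. F (d, Some (r, q, a)))) = U" .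
  qed
  then show ?thesis by simp
qed

lemma payoff_simps:
  "payoff i (d, None) = 0"
  "payoff i (d, Some (r, q, Cooperate)) = meeting_payoff i (Some (r, q))"
  "payoff i (d, Some (r, q, Defect)) = (if i = q then - \<gamma> else 0)"
  by (simp_all add: payoff_def meeting_payoff_def)

text \<open>The constant value solves the Bellman equation. Only the network after the link stage
  has to be \<open>g'\<close>, so this also covers a link that is cut in the first period
  counted.\<close>

lemma discounted_payoff_steady:
  assumes net: "network (g :: 'a network)" and "P h"
    and P: "\<And>h x. P h \<Longrightarrow> x \<in> set_pmf (period_pmf g \<sigma> h) \<Longrightarrow> P (x # h)"
    and links: "\<And>h d. P h \<Longrightarrow> d \<in> set_pmf (link_pmf g \<sigma> h) \<Longrightarrow> prune (current_network g h) d = g'"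
    and favors: "\<And>h d r q. P h \<Longrightarrow> {r, q} \<in> g' \<Longrightarrow> favor_pmf g \<sigma> h d r q = return_pmf Cooperate"
  shows "discounted_payoff g \<sigma> i h = utility g' i / (1 - \<delta>)"
proof -
  let ?V = "\<lambda>_. utility g' i / (1 - \<delta>)"
  have bellman: "measure_pmf.expectation (period_pmf g \<sigma> h) (\<lambda>x. payoff i x + \<delta> * ?V (x # h)) = ?V h"
    if "P h" for h
    using links[OF that] favors[OF that] delta_less
    by (intro expectation_period_eq[OF net, where K = "\<lambda>_. \<delta> * ?V h" and i = i])
       (auto simp: payoff_simps field_simps)
  show ?thesis
    using discounted_payoff_le[where P = P and V = ?V and M = "\<bar>?V h\<bar>", OF \<open>P h\<close> P eq_refl[OF bellman]]
      discounted_payoff_ge[where P = P and V = ?V and M = "\<bar>?V h\<bar>", OF \<open>P h\<close> P eq_refl[OF bellman[symmetric]]]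
    by auto
qed

end

lemma length_private_history [simp]: "length (private_history g i h) = length h"
  by (induction h) auto

text \<open>The length of a private history reveals the date, and there are finitely many histories
  of each length.\<close>

lemma finite_info_set: "finite (favor_exchange.info_set \<alpha> p (g :: 'a::finite network) i y)"
proof -
  define n where "n = length (fst (observed g i y))"
  let ?H = "{h :: 'a history. length h = n}"
  let ?F = "\<lambda>(h, d, r, q). Favor_Node h d r q"
  have "y' \<in> Link_Node ` ?H \<union> ?F ` (?H \<times> UNIV)" if "observed g i y' = observed g i y" for y'
  proof (cases y')
    case (Link_Node h)
    then show ?thesis
      using that[symmetric] by (simp add: n_def)
  next
    case (Favor_Node h d r q)
    then have "h \<in> ?H" "y' = ?F (h, d, r, q)"
      using that[symmetric] by (simp_all add: n_def)
    then show ?thesis by blast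
  qed
  then have "favor_exchange.info_set \<alpha> p g i y \<subseteq> Link_Node ` ?H \<union> ?F ` (?H \<times> UNIV)"
    unfolding favor_exchange.info_set_def by auto
  moreover have "finite (Link_Node ` ?H \<union> ?F ` (?H \<times> UNIV))"
    by (intro finite_UnI finite_imageI finite_SigmaI finite_histories) auto
  ultimately show ?thesis
    by (rule finite_subset)
qed

context favor_market
begin

section \<open>Stable networks have bounded degree\<close>

lemma cooperation_condition_iff: "cooperation_condition m \<longleftrightarrow>
    (1 - \<delta>) * (c - \<gamma>) \<le> \<delta> * (\<alpha> * v * (1 - p) ^ (m - 1) * p - \<alpha> * c * favor_share m)"
  by (simp add: cooperation_condition_def favor_share_def algebra_simps)

lemma utility_share: "utility (g :: 'a network) i = \<alpha> * v * (1 - (1 - p) ^ network_degree g i)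
    - (\<Sum>j\<in>neighbors g i. \<alpha> * c * favor_share (network_degree g j))"
  by (simp add: utility_def favor_share_def)

text \<open>Only the degrees of \<open>i\<close> and \<open>j\<close> change, and \<open>j\<close>
  leaves the cost sum. Hence the lost benefit depends on the degree of \<open>i\<close>, the saved
  cost on that of \<open>j\<close>.\<close>

lemma utility_remove_link:
  assumes net: "network (g :: 'a network)" and ij: "{i, j} \<in> g"
  shows "utility g i - utility (g - {{i, j}}) i
    = \<alpha> * v * (1 - p) ^ (network_degree g i - 1) * p - \<alpha> * c * favor_share (network_degree g j)"
proof -
  let ?g' = "g - {{i, j}}"
  have neq: "i \<noteq> j"
    using network_linked_neq[OF net ij] .
  have N: "neighbors ?g' i = neighbors g i - {j}"
    by (auto simp: neighbors_def doubleton_eq_iff)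
  have j: "j \<in> neighbors g i"
    using ij by (simp add: mem_neighbors_iff)
  obtain m where m: "network_degree g i = Suc m"
    using network_degree_pos[OF ij] gr0_conv_Suc by auto
  then have "network_degree ?g' i = m"
    using j by (simp add: network_degree_def N)
  moreover have "network_degree ?g' k = network_degree g k" if "k \<in> neighbors g i - {j}" for k
  proof -
    have "k \<noteq> i" "k \<noteq> j"
      using that neighbors_subset[OF net, of i] by auto
    then have "neighbors ?g' k = neighbors g k"
      by (auto simp: neighbors_def doubleton_eq_iff)
    then show ?thesis by (simp add: network_degree_def)
  qed
  ultimately show ?thesis
    using j m unfolding utility_share N
    by (simp add: sum.remove[of "neighbors g i" j] algebra_simps)
qed

lemma link_pmf_tendsto:
  assumes "profile_tendsto s \<sigma>"
  shows "(\<lambda>k. pmf (link_pmf (g :: 'a network) (s k) h) d) \<longlonglongrightarrow> pmf (link_pmf g \<sigma> h) d"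
proof (cases "\<forall>e. e \<notin> {(i, j). {i, j} \<in> current_network g h} \<longrightarrow> d e = Keep")
  case True
  let ?A = "{(i, j). {i, j} \<in> current_network g h}"
  have "pmf (Pi_pmf ?A Keep q) d = (\<Prod>e\<in>?A. pmf (q e) (d e))" for q
    using True by (intro pmf_Pi') auto
  then show ?thesis
    using assms unfolding link_pmf_def by (auto simp: profile_tendsto_def intro!: tendsto_prod)
next
  case False
  then have "pmf (link_pmf g \<sigma>' h) d = 0" for \<sigma>'
    unfolding link_pmf_def by (intro pmf_Pi_outside) auto
  then show ?thesis by simp
qed

lemma link_pmf_all_clean:
  assumes "\<And>k. cooperates_if_clean (g :: 'a network) \<sigma> k"
    "\<And>k l. {k, l} \<in> g \<Longrightarrow> clean_pair k l h"
  shows "link_pmf g \<sigma> h = return_pmf (\<lambda>_. Keep)"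
proof -
  have "d = (\<lambda>_. Keep)" if d: "d \<in> set_pmf (link_pmf g \<sigma> h)" for d
  proof
    fix e show "d e = Keep"
    proof (cases e)
      case (Pair k l)
      show ?thesis
      proof (cases "{k, l} \<in> g")
        case True
        then show ?thesis
          using link_profile_Keep[OF d assms(1) assms(2)] Pair by blast
      next
        case False
        then have "{k, l} \<notin> current_network g h"
          using current_network_subset by blast
        then show ?thesis
          using d Pair unfolding set_link_pmf by meson
      qed
    qed
  qed
  then have "set_pmf (link_pmf g \<sigma> h) \<subseteq> {\<lambda>_. Keep}"
    by auto
  then show ?thesis by (simp add: set_pmf_subset_singleton)
qed

text \<open>In period 0 the only uncertainty of \<open>i\<close> concerns link decisions of others.
  Under \<open>\<sigma>\<close> all links are kept, so \<open>y\<close> has positive probability and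
  all other nodes of its information set have none; Bayes' rule passes to the limit along whatever
  trembles justify \<open>\<mu>\<close>.\<close>

lemma initial_belief:
  assumes net: "network (g :: 'a network)" and coop: "\<And>k. cooperates_if_clean g \<sigma> k"
    and cons: "consistent g \<sigma> \<mu>" and ij: "{j, i} \<in> g"
  defines "y \<equiv> Favor_Node [] (\<lambda>_. Keep) j i"
  shows "feasible g y" "y \<in> info_set g i y" "\<mu> i y = 1"
    "\<And>y'. y' \<in> info_set g i y \<Longrightarrow> y' \<noteq> y \<Longrightarrow> \<mu> i y' = 0"
proof -
  have link: "link_pmf g \<sigma> [] = return_pmf (\<lambda>_. Keep)"
    using coop by (intro link_pmf_all_clean) auto
  let ?m = "pmf (meeting_pmf g) (Some (j, i))"
  have m: "0 < ?m"
    using pmf_meeting_Some_pos[OF net ij] .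
  then have "reach_prob g \<sigma> y = ?m"
    by (simp add: y_def link prune_Keep)
  then show feas: "feasible g y"
    using m unfolding feasible_def by metis
  show y: "y \<in> info_set g i y"
    using feas by (simp add: info_set_def y_def)
  \<comment> \<open>The length of the private history forces the history to be empty, so only the
    current link profile is open.\<close>
  have info: "\<exists>d. y' = Favor_Node [] d j i" if "y' \<in> info_set g i y" for y'
    using that by (cases y') (auto simp: info_set_def y_def dest: arg_cong[of _ _ length])
  have reach: "reach_prob g \<sigma> y' = (if y' = y then ?m else 0)" if y': "y' \<in> info_set g i y" for y'
    using info[OF y'] by (auto simp: y_def link prune_Keep indicator_def)
  from cons obtain s where s: "profile_tendsto s \<sigma>"
    and \<mu>: "\<And>i y. feasible g y \<Longrightarrow> moves_at i y \<Longrightarrow>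
      (\<lambda>k. reach_prob g (s k) y / (\<Sum>y'\<in>info_set g i y. reach_prob g (s k) y')) \<longlonglongrightarrow> \<mu> i y"
    unfolding consistent_def by blast
  have lim: "(\<lambda>k. reach_prob g (s k) y') \<longlonglongrightarrow> reach_prob g \<sigma> y'" if "y' \<in> info_set g i y" for y'
    using info[OF that] link_pmf_tendsto[OF s, of g "[]"] by (auto intro!: tendsto_intros)
  have "(\<lambda>k. \<Sum>y'\<in>info_set g i y. reach_prob g (s k) y') \<longlonglongrightarrow> (\<Sum>y'\<in>info_set g i y. reach_prob g \<sigma> y')"
    by (intro tendsto_sum lim)
  also have "(\<Sum>y'\<in>info_set g i y. reach_prob g \<sigma> y') = (\<Sum>y'\<in>info_set g i y. if y' = y then ?m else 0)"
    by (intro sum.cong refl reach)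
  also have "\<dots> = ?m"
    using y by (simp add: finite_info_set)
  finally have total: "(\<lambda>k. \<Sum>y'\<in>info_set g i y. reach_prob g (s k) y') \<longlonglongrightarrow> ?m" .
  have belief: "\<mu> i y' = reach_prob g \<sigma> y' / ?m" if y': "y' \<in> info_set g i y" for y'
  proof (rule LIMSEQ_unique)
    have "info_set g i y' = info_set g i y" "feasible g y'" "moves_at i y'"
      using y' by (auto simp: info_set_def)
    then show "(\<lambda>k. reach_prob g (s k) y' / (\<Sum>y'\<in>info_set g i y. reach_prob g (s k) y')) \<longlonglongrightarrow> \<mu> i y'"
      using \<mu>[of y' i] by simp
    show "(\<lambda>k. reach_prob g (s k) y' / (\<Sum>y'\<in>info_set g i y. reach_prob g (s k) y'))
        \<longlonglongrightarrow> reach_prob g \<sigma> y' / ?m"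
      using m by (intro tendsto_divide lim y' total) auto
  qed
  show "\<mu> i y = 1"
    using belief[OF y] reach[OF y] m by simp
  show "\<mu> i y' = 0" if "y' \<in> info_set g i y" "y' \<noteq> y" for y'
    using belief[OF that(1)] reach[OF that(1)] that(2) by simp
qed

text \<open>Every clean bilateral history occurs on the equilibrium path, and a bilateral strategy cannot
  distinguish its path occurrence from the others.\<close>

lemma cooperative_on_path_imp_cooperates_if_clean:
  assumes net: "network (g :: 'a network)" and meas: "bilaterally_measurable \<sigma>"
    and path: "cooperative_on_path g \<sigma>"
  shows "cooperates_if_clean g \<sigma> k"
proof -
  have path_period: "d = (\<lambda>_. Keep)" "x = Some (r, q, a) \<Longrightarrow> a = Cooperate"
    if "(d, x) # h \<in> set_pmf (run g \<sigma> [] n)" for d x h n r q a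
  proof -
    have "\<forall>(d, x)\<in>set ((d, x) # h). (\<forall>e. d e = Keep) \<and> (\<forall>r q a. x = Some (r, q, a) \<longrightarrow> a = Cooperate)"
      using path that unfolding cooperative_on_path_def by blast
    then show "d = (\<lambda>_. Keep)" "x = Some (r, q, a) \<Longrightarrow> a = Cooperate"
      by auto
  qed
  \<comment> \<open>A period without a meeting always has positive probability, so any link profile
    possible after a path history occurs on the path itself.\<close>
  have link: "d = (\<lambda>_. Keep)" if h: "h \<in> set_pmf (run g \<sigma> [] n)" and d: "d \<in> set_pmf (link_pmf g \<sigma> h)"
    for h n d
  proof -
    have "(d, None) # h \<in> set_pmf (run g \<sigma> [] (Suc n))"
      using h set_period_pmf_None[OF net d] by auto
    then show ?thesis
      using path_period by blast
  qed
  have keep: "(\<lambda>_. Keep) \<in> set_pmf (link_pmf g \<sigma> h)" if "h \<in> set_pmf (run g \<sigma> [] n)" for h n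
    using link[OF that] set_pmf_not_empty[of "link_pmf g \<sigma> h"] by (metis all_not_in_conv)
  have favor: "a = Cooperate" if h: "h \<in> set_pmf (run g \<sigma> [] n)" and cur: "current_network g h = g"
    and rq: "{r, q} \<in> g" and a: "a \<in> set_pmf (favor_pmf g \<sigma> h (\<lambda>_. Keep) r q)" for h n r q a
  proof -
    have "((\<lambda>_. Keep), Some (r, q, a)) # h \<in> set_pmf (run g \<sigma> [] (Suc n))"
      using h set_period_pmf_Some[OF net keep[OF h] _ a] by (auto simp: prune_Keep cur rq)
    then show ?thesis
      using path_period by blast
  qed
  \<comment> \<open>\<open>None\<close> entries are realized by periods without a meeting, the
    others by the corresponding meeting of \<open>k\<close> and \<open>l\<close>; both have positive
    probability.\<close>
  have path_history: "\<exists>h\<in>set_pmf (run g \<sigma> [] (length b)).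
      current_network g h = g \<and> bilateral_history k l (private_history g k h) = b"
    if kl: "{k, l} \<in> g" and b: "\<forall>y\<in>set b. y = None \<or> (\<exists>r q. y = Some (r, q, Cooperate) \<and> {r, q} = {k, l})"
    for b l
    using b
  proof (induction b)
    case Nil
    then show ?case by (simp add: bilateral_history_def)
  next
    case (Cons y b)
    then obtain h where h: "h \<in> set_pmf (run g \<sigma> [] (length b))" "current_network g h = g"
      "bilateral_history k l (private_history g k h) = b"
      by auto
    have "((\<lambda>_. Keep), y) \<in> set_pmf (period_pmf g \<sigma> h)"
    proof (cases y)
      case None
      then show ?thesis
        using set_period_pmf_None[OF net keep[OF h(1)]] by simp
    next
      case (Some w)
      then obtain r q where y: "y = Some (r, q, Cooperate)" "{r, q} = {k, l}"
        using Cons.prems by auto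
      obtain a where a: "a \<in> set_pmf (favor_pmf g \<sigma> h (\<lambda>_. Keep) r q)"
        using set_pmf_not_empty by fast
      then have "a = Cooperate"
        using favor[OF h(1,2) _ a] y(2) kl by simp
      then show ?thesis
        using set_period_pmf_Some[OF net keep[OF h(1)] _ a] y kl by (simp add: h(2) prune_Keep)
    qed
    then have "((\<lambda>_. Keep), y) # h \<in> set_pmf (run g \<sigma> [] (length (y # b)))"
      using h(1) by auto
    moreover have "bilateral_history k l (private_history g k (((\<lambda>_. Keep), y) # h)) = y # b"
      using h(3) Cons.prems by (auto simp: bilateral_history_Cons own_play_def doubleton_eq_iff split: option.splits)
    moreover have "current_network g (((\<lambda>_. Keep), y) # h) = g"
      using h(2) by (simp add: prune_Keep)
    ultimately show ?case by blast
  qed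
  show ?thesis
    unfolding cooperates_if_clean_def
  proof (intro allI impI, elim conjE)
    fix l x assume kl: "{k, l} \<in> g" and clean: "clean k l x"
    have neq: "l \<noteq> k"
      using network_linked_neq[OF net kl] by simp
    let ?b = "bilateral_history k l x"
    have "\<forall>y\<in>set ?b. y = None \<or> (\<exists>r q. y = Some (r, q, Cooperate) \<and> {r, q} = {k, l})"
    proof
      fix y assume y: "y \<in> set ?b"
      then have "\<forall>r q a. y = Some (r, q, a) \<longrightarrow> {r, q} = {k, l}"
        by (auto simp: bilateral_history_def doubleton_eq_iff split: option.splits if_splits)
      then show "y = None \<or> (\<exists>r q. y = Some (r, q, Cooperate) \<and> {r, q} = {k, l})"
        using y clean unfolding clean_def by (cases y) auto
    qed
    from path_history[OF kl this] obtain h where h: "h \<in> set_pmf (run g \<sigma> [] (length ?b))"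
      "current_network g h = g" "bilateral_history k l (private_history g k h) = ?b"
      by blast
    let ?x = "private_history g k h"
    have "set_pmf (link_choice (\<sigma> k) ?x l) \<subseteq> {Keep}"
    proof
      fix b assume b: "b \<in> set_pmf (link_choice (\<sigma> k) ?x l)"
      \<comment> \<open>Link decisions are drawn independently, so altering one coordinate to
        another possible value stays in the support, where only all-\<open>Keep\<close>
        occurs.\<close>
      have "(\<lambda>_. Keep)((k, l) := b) \<in> set_pmf (link_pmf g \<sigma> h)"
        using keep[OF h(1)] b kl unfolding set_link_pmf h(2) by auto
      from link[OF h(1) this] show "b \<in> {Keep}"
        by (metis fun_upd_same singletonI)
    qed
    then have "link_choice (\<sigma> k) ?x l = return_pmf Keep"
      by (simp add: set_pmf_subset_singleton)
    moreover have "set_pmf (favor_pmf g \<sigma> h (\<lambda>_. Keep) l k) \<subseteq> {Cooperate}"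
      using favor[OF h(1,2), of l k] kl by (auto simp: insert_commute)
    then have "favor_choice (\<sigma> k) ?x (link_info g k h (\<lambda>_. Keep)) l = return_pmf Cooperate"
      by (simp add: set_pmf_subset_singleton favor_pmf_def)
    ultimately show "link_choice (\<sigma> k) x l = return_pmf Keep
        \<and> (\<forall>y. favor_choice (\<sigma> k) x y l = return_pmf Cooperate)"
      using meas neq h(3) unfolding bilaterally_measurable_def by metis
  qed
qed

lemma cooperative_payoff:
  assumes net: "network (g :: 'a network)" and coop: "\<And>k. cooperates_if_clean g \<sigma> k"
    and h: "current_network g h = g" "\<And>k l. {k, l} \<in> g \<Longrightarrow> clean_pair k l h"
  shows "discounted_payoff g \<sigma> i h = utility g i / (1 - \<delta>)"
proof (rule discounted_payoff_steady[OF net,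
      where P = "\<lambda>h. current_network g h = g \<and> (\<forall>k l. {k, l} \<in> g \<longrightarrow> clean_pair k l h)"])
  fix h x
  assume P: "current_network g h = g \<and> (\<forall>k l. {k, l} \<in> g \<longrightarrow> clean_pair k l h)"
  then have link: "link_pmf g \<sigma> h = return_pmf (\<lambda>_. Keep)"
    using coop by (intro link_pmf_all_clean) auto
  then show "prune (current_network g h) d = g" if "d \<in> set_pmf (link_pmf g \<sigma> h)" for d
    using that P by (simp add: prune_Keep)
  show favor: "favor_pmf g \<sigma> h d r q = return_pmf Cooperate" if "{r, q} \<in> g" for d r q
    using favor_pmf_Cooperate[OF coop that] P that by blast
  assume "x \<in> set_pmf (period_pmf g \<sigma> h)"
  then show "current_network g (x # h) = g \<and> (\<forall>k l. {k, l} \<in> g \<longrightarrow> clean_pair k l (x # h))"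
    by (rule set_period_pmf[OF net])
       (use link P favor in \<open>auto simp: prune_Keep clean_pair_Cons\<close>)
qed (use h in auto)

text \<open>The refusal enters only the bilateral history of \<open>i\<close> and \<open>j\<close>;
  all other links stay clean and active. How \<open>j\<close> would punish is irrelevant, because
  \<open>i\<close> cuts the link herself.\<close>

lemma cut_off_payoff:
  assumes net: "network (g :: 'a network)" and coop: "\<And>k. cooperates_if_clean g \<sigma> k"
    and ij: "{i, j} \<in> g"
  defines "\<tau> \<equiv> \<lparr>link_choice = \<lambda>x k. return_pmf (if k = j \<and> x \<noteq> [] then Remove else Keep),
      favor_choice = \<lambda>x y k. return_pmf (if k = j then Defect else Cooperate)\<rparr>"
  shows "discounted_payoff g (\<sigma>(i := \<tau>)) i [((\<lambda>_. Keep), Some (j, i, Defect))]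
    = utility (g - {{i, j}}) i / (1 - \<delta>)"
proof -
  let ?g' = "g - {{i, j}}" and ?\<sigma> = "\<sigma>(i := \<tau>)"
  \<comment> \<open>An inclusion, since \<open>{i, j}\<close> is still present when the first of
    these periods begins; \<open>h \<noteq> []\<close> makes \<open>\<tau>\<close> remove
    it.\<close>
  let ?P = "\<lambda>h. h \<noteq> [] \<and> ?g' \<subseteq> current_network g h \<and> (\<forall>k l. {k, l} \<in> ?g' \<longrightarrow> clean_pair k l h)"
  have coop': "cooperates_if_clean ?g' ?\<sigma> k" for k
    using coop[of k] by (auto simp: cooperates_if_clean_def \<tau>_def)
  show ?thesis
  proof (rule discounted_payoff_steady[OF net, where P = ?P])
    fix h x
    assume P: "?P h"
    have keep: "d (k, l) = Keep" if d: "d \<in> set_pmf (link_pmf g ?\<sigma> h)" and kl: "{k, l} \<in> ?g'" for d k l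
    proof -
      have "{k, l} \<in> current_network g h" "clean_pair k l h"
        using P kl by auto
      moreover have "link_choice (?\<sigma> k) (private_history g k h) l = return_pmf Keep"
        using coop'[of k] kl \<open>clean_pair k l h\<close> by (auto simp: cooperates_if_clean_def)
      ultimately show ?thesis
        using d unfolding set_link_pmf by (metis set_return_pmf singletonD)
    qed
    show prune: "prune (current_network g h) d = ?g'" if d: "d \<in> set_pmf (link_pmf g ?\<sigma> h)" for d
    proof
      have "private_history g i h \<noteq> []"
        using P by (metis length_0_conv length_private_history)
      then have "d (i, j) = Remove" if "{i, j} \<in> current_network g h"
        using d that unfolding set_link_pmf by (auto simp: \<tau>_def split: if_splits)
      then have "{i, j} \<notin> prune (current_network g h) d"
        by (auto simp: link_in_prune_iff)
      then show "prune (current_network g h) d \<subseteq> ?g'"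
        using prune_subset[of "current_network g h" d] current_network_subset[of g h] by blast
      show "?g' \<subseteq> prune (current_network g h) d"
      proof
        fix e assume e: "e \<in> ?g'"
        then obtain k l where kl: "e = {k, l}"
          using net[unfolded network_def] by (metis DiffD1 card_2_iff)
        moreover have "{l, k} \<in> ?g'"
          using e kl by (simp add: insert_commute)
        ultimately show "e \<in> prune (current_network g h) d"
          using keep[OF d] P e by (auto simp: link_in_prune_iff)
      qed
    qed
    show favor: "favor_pmf g ?\<sigma> h d r q = return_pmf Cooperate" if rq: "{r, q} \<in> ?g'" for d r q
    proof -
      have qr: "{q, r} \<in> ?g'"
        using rq by (simp add: insert_commute)
      then have "clean q r (private_history g q h)"
        using P by (metis clean_private_history)
      then show ?thesis
        using coop'[of q] qr unfolding cooperates_if_clean_def favor_pmf_def by blast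
    qed
    assume "x \<in> set_pmf (period_pmf g ?\<sigma> h)"
    then show "?P (x # h)"
      by (rule set_period_pmf[OF net])
         (use prune P favor in \<open>auto simp: clean_pair_Cons\<close>)
  qed (auto simp: prune_Keep clean_pair_Cons doubleton_eq_iff)
qed

theorem stable_cooperation_condition:
  assumes stable: "stable (g :: 'a network)" and ij: "{i, j} \<in> g"
    and max: "\<And>k. network_degree g k \<le> network_degree g i"
  shows "cooperation_condition (network_degree g i)"
proof -
  from stable obtain \<sigma> \<mu> where net: "network g" and meas: "bilaterally_measurable \<sigma>"
    and path: "cooperative_on_path g \<sigma>" and cons: "consistent g \<sigma> \<mu>"
    and rational: "sequentially_rational g \<sigma> \<mu>"
    by (auto simp: stable_def bilateral_equilibrium_def)
  have coop: "cooperates_if_clean g \<sigma> k" for k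
    by (rule cooperative_on_path_imp_cooperates_if_clean[OF net meas path])
  have neq: "i \<noteq> j"
    using network_linked_neq[OF net ij] .
  have ji: "{j, i} \<in> g"
    using ij by (simp add: insert_commute)
  let ?y = "Favor_Node [] (\<lambda>_. Keep) j i"
  note belief = initial_belief[OF net coop cons ji]
  have collapse: "(\<Sum>y'\<in>info_set g i ?y. \<mu> i y' * F y') = F ?y" for F :: "'a node \<Rightarrow> real"
  proof -
    have "(\<Sum>y'\<in>info_set g i ?y. \<mu> i y' * F y') = (\<Sum>y'\<in>{?y}. \<mu> i y' * F y')"
      using belief by (intro sum.mono_neutral_right finite_info_set) auto
    then show ?thesis using belief(3) by simp
  qed
  have le: "node_payoff g (\<sigma>(i := \<tau>)) i ?y \<le> node_payoff g \<sigma> i ?y" for \<tau>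
    using rational[unfolded sequentially_rational_def, rule_format, of ?y i \<tau>] belief(1)
    unfolding collapse by simp
  have "node_payoff g \<sigma> i ?y = - c + \<delta> * (utility g i / (1 - \<delta>))"
    using neq favor_pmf_Cooperate[OF coop ji, of "[]"]
    by (simp add: payoff_def cooperative_payoff[OF net coop] prune_Keep clean_pair_Cons)
  moreover
  let ?\<tau> = "\<lparr>link_choice = \<lambda>x k. return_pmf (if k = j \<and> x \<noteq> [] then Remove else Keep),
      favor_choice = \<lambda>x y k. return_pmf (if k = j then Defect else Cooperate)\<rparr>"
  have "node_payoff g (\<sigma>(i := ?\<tau>)) i ?y = - \<gamma> + \<delta> * (utility (g - {{i, j}}) i / (1 - \<delta>))"
    using neq by (simp add: payoff_def favor_pmf_def cut_off_payoff[OF net coop ij])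
  ultimately have "c - \<gamma> \<le> \<delta> * (utility g i / (1 - \<delta>)) - \<delta> * (utility (g - {{i, j}}) i / (1 - \<delta>))"
    using le[of ?\<tau>] by linarith
  also have "\<dots> = \<delta> * (utility g i - utility (g - {{i, j}}) i) / (1 - \<delta>)"
    by (simp add: right_diff_distrib diff_divide_distrib)
  finally have "(1 - \<delta>) * (c - \<gamma>) \<le> \<delta> * (utility g i - utility (g - {{i, j}}) i)"
    using delta_less by (simp add: pos_le_divide_eq mult.commute)
  \<comment> \<open>Maximality enters here: \<open>j\<close> has no larger degree than
    \<open>i\<close>, so her share is at least that of \<open>i\<close>, and the loss from cutting
    the link is at most the one in the condition.\<close>
  also have "\<dots> \<le> \<delta> * (\<alpha> * v * (1 - p) ^ (network_degree g i - 1) * p - \<alpha> * c * favor_share (network_degree g i))"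
    unfolding utility_remove_link[OF net ij]
    using delta_pos alpha_pos c_pos favor_share_antimono[OF network_degree_pos[OF ji] max]
    by (intro mult_left_mono diff_left_mono) auto
  finally show ?thesis
    unfolding cooperation_condition_iff .
qed

corollary stable_degree_le:
  assumes "cooperation_bound B" "stable (g :: 'a network)"
  shows "network_degree g k \<le> B"
proof -
  have "Max (range (network_degree g)) \<in> range (network_degree g)"
    by (intro Max_in) auto
  then obtain i where i: "network_degree g i = Max (range (network_degree g))"
    by (metis imageE)
  then have max: "network_degree g l \<le> network_degree g i" for l
    by simp
  have "network_degree g i \<le> B"
  proof (cases "neighbors g i = {}")
    case True
    then show ?thesis by (simp add: network_degree_def)
  next
    case False
    then obtain j where "{i, j} \<in> g"
      by (auto simp: neighbors_def)
    then have "cooperation_condition (network_degree g i)"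
      using stable_cooperation_condition[OF assms(2) _ max] by blast
    then show ?thesis
      using assms(1) unfolding cooperation_bound_def by (meson not_le)
  qed
  then show ?thesis
    using max[of k] by linarith
qed

end

text \<open>Dividing by the least power of \<open>\<epsilon>\<close> leaves terms with a positive
  limit exactly where the exponent \<open>a\<close> is minimal. Hence limit beliefs exist and
  concentrate on the nodes with the fewest trembles.\<close>

lemma ratio_of_powers_limit:
  fixes C :: "'b \<Rightarrow> real" and a b :: "'b \<Rightarrow> nat" and \<epsilon> :: "nat \<Rightarrow> real"
  assumes fin: "finite Y" and y: "y \<in> Y" and C: "\<And>y. y \<in> Y \<Longrightarrow> 0 < C y"
    and \<epsilon>: "\<epsilon> \<longlonglongrightarrow> 0" "\<And>n. 0 < \<epsilon> n"
  defines "T \<equiv> \<lambda>y n. C y * \<epsilon> n ^ a y * (1 - \<epsilon> n) ^ b y"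
  shows "\<exists>L. (\<lambda>n. T y n / (\<Sum>y'\<in>Y. T y' n)) \<longlonglongrightarrow> L \<and> 0 \<le> L
    \<and> (\<forall>y'\<in>Y. a y' < a y \<longrightarrow> L = 0)"
proof -
  define m where "m = Min (a ` Y)"
  have m: "m \<le> a y'" if "y' \<in> Y" for y'
    using that fin by (simp add: m_def)
  have "m \<in> a ` Y"
    unfolding m_def using fin y by (intro Min_in) auto
  then obtain y0 where y0: "y0 \<in> Y" "a y0 = m"
    by auto
  define R where "R = (\<lambda>y n. C y * \<epsilon> n ^ (a y - m) * (1 - \<epsilon> n) ^ b y)"
  \<comment> \<open>The power of 0 is an indicator of \<open>a y = m\<close>, as
    \<open>0 ^ 0 = 1\<close>.\<close>
  define L where "L = (\<lambda>y. C y * 0 ^ (a y - m))"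
  have T: "T y' n = \<epsilon> n ^ m * R y' n" if "y' \<in> Y" for y' n
    using m[OF that] by (simp add: T_def R_def flip: power_add)
  have lim: "R y' \<longlonglongrightarrow> L y'" for y'
  proof -
    have "R y' \<longlonglongrightarrow> C y' * 0 ^ (a y' - m) * (1 - 0) ^ b y'"
      unfolding R_def by (intro tendsto_intros \<epsilon>)
    then show ?thesis by (simp add: L_def)
  qed
  have L: "0 \<le> L y'" if "y' \<in> Y" for y'
    using C[OF that] by (simp add: L_def)
  have pos: "0 < (\<Sum>y'\<in>Y. L y')"
    using y0 C[OF y0(1)] by (intro sum_pos2[OF fin y0(1)] L) (simp_all add: L_def)
  have "(\<lambda>n. T y n / (\<Sum>y'\<in>Y. T y' n)) = (\<lambda>n. R y n / (\<Sum>y'\<in>Y. R y' n))"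
  proof
    fix n
    have "(\<Sum>y'\<in>Y. T y' n) = \<epsilon> n ^ m * (\<Sum>y'\<in>Y. R y' n)"
      using T by (simp add: sum_distrib_left)
    then show "T y n / (\<Sum>y'\<in>Y. T y' n) = R y n / (\<Sum>y'\<in>Y. R y' n)"
      using T[OF y] \<epsilon>(2)[of n] by simp
  qed
  moreover have "(\<lambda>n. R y n / (\<Sum>y'\<in>Y. R y' n)) \<longlonglongrightarrow> L y / (\<Sum>y'\<in>Y. L y')"
    using pos by (intro tendsto_divide tendsto_sum lim) auto
  moreover have "L y / (\<Sum>y'\<in>Y. L y') = 0" if "y' \<in> Y" "a y' < a y" for y'
    using m[OF that(1)] that(2) by (simp add: L_def power_0_left)
  moreover have "0 \<le> L y / (\<Sum>y'\<in>Y. L y')"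
    using L[OF y] pos by simp
  ultimately show ?thesis
    by (intro exI[of _ "L y / (\<Sum>y'\<in>Y. L y')"]) simp
qed

section \<open>Bilateral grim trigger with trembles\<close>

definition tremble :: "real \<Rightarrow> 'b \<Rightarrow> 'b \<Rightarrow> 'b pmf" where
  "tremble \<epsilon> x y = map_pmf (\<lambda>b. if b then y else x) (bernoulli_pmf \<epsilon>)"

lemma tremble_0: "tremble 0 x y = return_pmf x"
proof -
  have "bernoulli_pmf 0 = return_pmf False"
  proof (rule pmf_eqI)
    fix b show "pmf (bernoulli_pmf 0) b = pmf (return_pmf False) b"
      by (cases b) auto
  qed
  then show ?thesis by (simp add: tremble_def)
qed

lemma set_tremble: "0 < \<epsilon> \<Longrightarrow> \<epsilon> < 1 \<Longrightarrow> set_pmf (tremble \<epsilon> x y) = {x, y}"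
  by (auto simp: tremble_def)

lemma pmf_tremble:
  assumes "0 \<le> \<epsilon>" "\<epsilon> \<le> 1" "x \<noteq> y"
  shows "pmf (tremble \<epsilon> x y) x = 1 - \<epsilon>" "pmf (tremble \<epsilon> x y) y = \<epsilon>"
proof -
  have "inj (\<lambda>b. if b then y else x)"
    using assms(3) by (auto simp: inj_def)
  from pmf_map_inj'[OF this, of "bernoulli_pmf \<epsilon>"] show "pmf (tremble \<epsilon> x y) x = 1 - \<epsilon>" "pmf (tremble \<epsilon> x y) y = \<epsilon>"
    using assms(1,2) unfolding tremble_def
    by (metis pmf_bernoulli_False, metis pmf_bernoulli_True)
qed

text \<open>One family for two purposes: \<open>\<epsilon> = 0\<close> is the candidate equilibrium,
  small \<open>\<epsilon> > 0\<close> the perturbation behind its beliefs. A uniform rate makes the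
  order of a reach probability equal to the number of trembles.\<close>

definition grim :: "real \<Rightarrow> 'a profile" where
  "grim \<epsilon> k = \<lparr>link_choice = \<lambda>x l. if clean k l x then tremble \<epsilon> Keep Remove else tremble \<epsilon> Remove Keep,
     favor_choice = \<lambda>x y l. if clean k l x then tremble \<epsilon> Cooperate Defect else tremble \<epsilon> Defect Cooperate\<rparr>"

lemma pmf_grim:
  assumes "0 \<le> \<epsilon>" "\<epsilon> \<le> 1"
  shows "pmf (link_choice (grim \<epsilon> k) x l) b = (if (b = Keep) = clean k l x then 1 - \<epsilon> else \<epsilon>)"
    and "pmf (favor_choice (grim \<epsilon> k) x y l) a = (if (a = Cooperate) = clean k l x then 1 - \<epsilon> else \<epsilon>)"
proof -
  show "pmf (link_choice (grim \<epsilon> k) x l) b = (if (b = Keep) = clean k l x then 1 - \<epsilon> else \<epsilon>)"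
    using assms by (cases b) (auto simp: grim_def pmf_tremble)
  show "pmf (favor_choice (grim \<epsilon> k) x y l) a = (if (a = Cooperate) = clean k l x then 1 - \<epsilon> else \<epsilon>)"
    using assms by (cases a) (auto simp: grim_def pmf_tremble)
qed

lemma grim_0:
  "link_choice (grim 0 k) x l = return_pmf (if clean k l x then Keep else Remove)"
  "favor_choice (grim 0 k) x y l = return_pmf (if clean k l x then Cooperate else Defect)"
  by (simp_all add: grim_def tremble_0)

lemma grim_bilaterally_measurable: "bilaterally_measurable (grim \<epsilon>)"
  by (simp add: bilaterally_measurable_def grim_def clean_def)

lemma grim_totally_mixed: "0 < \<epsilon> \<Longrightarrow> \<epsilon> < 1 \<Longrightarrow> totally_mixed (grim \<epsilon>)"
  using link_decision.exhaust favor_decision.exhaust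
  by (auto simp: totally_mixed_def grim_def set_tremble)

lemma grim_cooperates_if_clean: "cooperates_if_clean g (grim 0) k"
  by (simp add: cooperates_if_clean_def grim_0)

lemma grim_tendsto:
  assumes "\<epsilon> \<longlonglongrightarrow> 0" "\<And>n. 0 < \<epsilon> n" "\<And>n. \<epsilon> n < 1"
  shows "profile_tendsto (\<lambda>n. grim (\<epsilon> n)) (grim 0)"
proof -
  have "(\<lambda>n. if P then 1 - \<epsilon> n else \<epsilon> n) \<longlonglongrightarrow> (if P then 1 - 0 else 0)" for P
    using assms(1) tendsto_diff[OF tendsto_const assms(1)] by auto
  then show ?thesis
    using assms by (simp add: profile_tendsto_def pmf_grim less_imp_le)
qed

text \<open>For \<open>b = False\<close>, the following count trembles, otherwise the decisions that follow grim trigger.\<close>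

definition agreements :: "bool \<Rightarrow> 'a network \<Rightarrow> 'a history \<Rightarrow> 'a link_profile \<Rightarrow> nat" where
  "agreements b g h d = card {(k, l). {k, l} \<in> current_network g h \<and> ((d (k, l) = Keep) = clean_pair k l h) = b}"

definition favor_agreements :: "bool \<Rightarrow> 'a history \<Rightarrow> 'a play option \<Rightarrow> nat" where
  "favor_agreements b h x = (case x of None \<Rightarrow> 0
     | Some (r, q, a) \<Rightarrow> of_bool (((a = Cooperate) = clean_pair q r h) = b))"

primrec history_agreements :: "bool \<Rightarrow> 'a network \<Rightarrow> 'a history \<Rightarrow> nat" where
  "history_agreements b g [] = 0"
| "history_agreements b g (x # h) =
     history_agreements b g h + agreements b g h (fst x) + favor_agreements b h (snd x)"

fun node_agreements :: "bool \<Rightarrow> 'a network \<Rightarrow> 'a node \<Rightarrow> nat" where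
  "node_agreements b g (Link_Node h) = history_agreements b g h"
| "node_agreements b g (Favor_Node h d r q) = history_agreements b g h + agreements b g h d"

definition dummy_Keep :: "'a network \<Rightarrow> 'a history \<Rightarrow> 'a link_profile \<Rightarrow> bool" where
  "dummy_Keep g h d \<longleftrightarrow> (\<forall>k l. {k, l} \<notin> current_network g h \<longrightarrow> d (k, l) = Keep)"

lemma pmf_link_grim:
  assumes "0 \<le> \<epsilon>" "\<epsilon> \<le> 1"
  shows "pmf (favor_exchange.link_pmf (g :: 'a::finite network) (grim \<epsilon>) h) d
    = of_bool (dummy_Keep g h d) * (\<epsilon> ^ agreements False g h d * (1 - \<epsilon>) ^ agreements True g h d)"
proof -
  let ?A = "{(k, l). {k, l} \<in> current_network g h}"
  let ?q = "\<lambda>(k, l). link_choice (grim \<epsilon> k) (private_history g k h) l"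
  have "pmf (Pi_pmf ?A Keep ?q) d = of_bool (dummy_Keep g h d) * (\<Prod>e\<in>?A. pmf (?q e) (d e))"
    by (subst pmf_Pi) (auto simp: dummy_Keep_def)
  also have "(\<Prod>e\<in>?A. pmf (?q e) (d e))
      = (\<Prod>e\<in>?A. if (d e = Keep) = (case e of (k, l) \<Rightarrow> clean_pair k l h) then 1 - \<epsilon> else \<epsilon>)"
    using assms by (intro prod.cong refl) (auto simp: pmf_grim)
  also have "\<dots> = (1 - \<epsilon>) ^ card (?A \<inter> {e. (d e = Keep) = (case e of (k, l) \<Rightarrow> clean_pair k l h)})
      * \<epsilon> ^ card (?A \<inter> - {e. (d e = Keep) = (case e of (k, l) \<Rightarrow> clean_pair k l h)})"
    by (simp add: prod.If_cases)
  also have "?A \<inter> {e. (d e = Keep) = (case e of (k, l) \<Rightarrow> clean_pair k l h)}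
      = {(k, l). {k, l} \<in> current_network g h \<and> ((d (k, l) = Keep) = clean_pair k l h) = True}"
    by auto
  also have "?A \<inter> - {e. (d e = Keep) = (case e of (k, l) \<Rightarrow> clean_pair k l h)}
      = {(k, l). {k, l} \<in> current_network g h \<and> ((d (k, l) = Keep) = clean_pair k l h) = False}"
    by auto
  finally show ?thesis
    unfolding favor_exchange.link_pmf_def agreements_def by (simp add: mult.commute)
qed

section \<open>Reach probabilities under trembling grim trigger\<close>

context favor_market
begin

lemma pmf_period_None: "pmf (period_pmf (g :: 'a network) \<sigma> h) (d, None)
    = pmf (link_pmf g \<sigma> h) d * pmf (meeting_pmf (prune (current_network g h) d)) None"
  unfolding period_pmf_def
  by (subst pmf_bind_unique[where x = d], force simp: set_pmf_iff[symmetric] pmf_eq_0_set_pmf split: option.splits,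
      subst pmf_bind_unique[where x = None]) (auto simp: pmf_eq_0_set_pmf split: option.splits)

lemma pmf_period_Some: "pmf (period_pmf (g :: 'a network) \<sigma> h) (d, Some (r, q, a))
    = pmf (link_pmf g \<sigma> h) d * pmf (meeting_pmf (prune (current_network g h) d)) (Some (r, q))
      * pmf (favor_pmf g \<sigma> h d r q) a"
proof -
  have "inj (\<lambda>a. (d, Some (r, q, a)))"
    by (simp add: inj_def)
  from pmf_map_inj'[OF this] show ?thesis
    unfolding period_pmf_def
    by (subst pmf_bind_unique[where x = d], force simp: pmf_eq_0_set_pmf split: option.splits,
        subst pmf_bind_unique[where x = "Some (r, q)"]) (auto simp: pmf_eq_0_set_pmf split: option.splits)
qed

lemma pmf_run_Suc: "pmf (run (g :: 'a network) \<sigma> [] (Suc (length h))) (x # h)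
    = pmf (run g \<sigma> [] (length h)) h * pmf (period_pmf g \<sigma> h) x"
proof -
  have "inj (\<lambda>x. x # h)"
    by (simp add: inj_def)
  from pmf_map_inj'[OF this] show ?thesis
    by (simp, subst pmf_bind_unique[where x = h]) (auto simp: pmf_eq_0_set_pmf)
qed

text \<open>Nature's factor in the probability of a period, together with the support condition on
  link profiles. It does not involve strategies, so \<open>\<epsilon>\<close> enters reach
  probabilities only through powers of \<open>\<epsilon>\<close> and
  \<open>1 - \<epsilon>\<close>.\<close>

definition period_chance :: "'a network \<Rightarrow> 'a history \<Rightarrow> 'a link_profile \<Rightarrow> ('a \<times> 'a) option \<Rightarrow> real" where
  "period_chance g h d m = of_bool (dummy_Keep g h d) * pmf (meeting_pmf (prune (current_network g h) d)) m"

abbreviation meeting :: "'a play option \<Rightarrow> ('a \<times> 'a) option" where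
  "meeting \<equiv> map_option (\<lambda>(r, q, a). (r, q))"

primrec chance :: "'a network \<Rightarrow> 'a history \<Rightarrow> real" where
  "chance g [] = 1"
| "chance g (x # h) = chance g h * period_chance g h (fst x) (meeting (snd x))"

fun node_chance :: "'a network \<Rightarrow> 'a node \<Rightarrow> real" where
  "node_chance g (Link_Node h) = chance g h"
| "node_chance g (Favor_Node h d r q) = chance g h * period_chance g h d (Some (r, q))"

lemma pmf_run_grim:
  assumes "0 \<le> \<epsilon>" "\<epsilon> \<le> 1"
  shows "pmf (run g (grim \<epsilon>) [] (length h)) h
    = chance g h * \<epsilon> ^ history_agreements False g h * (1 - \<epsilon>) ^ history_agreements True g h"
proof (induction h)
  case (Cons x h)
  obtain d y where x: "x = (d, y)"
    by fastforce
  have "pmf (period_pmf g (grim \<epsilon>) h) (d, y)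
      = period_chance g h d (meeting y) * \<epsilon> ^ (agreements False g h d + favor_agreements False h y)
        * (1 - \<epsilon>) ^ (agreements True g h d + favor_agreements True h y)"
  proof (cases y)
    case None
    then show ?thesis
      using assms by (simp add: pmf_period_None pmf_link_grim period_chance_def favor_agreements_def)
  next
    case (Some w)
    then obtain r q a where y: "y = Some (r, q, a)"
      by (metis prod.collapse)
    have "pmf (favor_pmf g (grim \<epsilon>) h d r q) a
        = \<epsilon> ^ favor_agreements False h y * (1 - \<epsilon>) ^ favor_agreements True h y"
      using assms by (simp add: y favor_pmf_def pmf_grim favor_agreements_def)
    then show ?thesis
      using assms unfolding y by (simp add: pmf_period_Some pmf_link_grim period_chance_def power_add)
  qed
  then show ?case
    using Cons pmf_run_Suc[of g "grim \<epsilon>" h x] by (simp add: x power_add del: run.simps)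
qed simp

lemma reach_prob_grim:
  assumes "0 \<le> \<epsilon>" "\<epsilon> \<le> 1"
  shows "reach_prob g (grim \<epsilon>) y
    = node_chance g y * \<epsilon> ^ node_agreements False g y * (1 - \<epsilon>) ^ node_agreements True g y"
  by (cases y) (simp_all add: assms pmf_run_grim pmf_link_grim period_chance_def power_add)

lemma chance_nonneg: "0 \<le> chance g h"
  by (induction h) (auto simp: period_chance_def)

lemma dummy_Keep_if_pmf_pos: "pmf (link_pmf (g :: 'a network) \<sigma> h) d \<noteq> 0 \<Longrightarrow> dummy_Keep g h d"
  unfolding dummy_Keep_def using set_link_pmf[of d g \<sigma> h] by (metis set_pmf_iff)

lemma chance_pos:
  "pmf (run g \<sigma> [] (length h)) h \<noteq> 0 \<Longrightarrow> 0 < chance g h"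
proof (induction h)
  case (Cons x h)
  then have ne: "pmf (run g \<sigma> [] (length h)) h \<noteq> 0" "pmf (period_pmf g \<sigma> h) x \<noteq> 0"
    using pmf_run_Suc[of g \<sigma> h x] by auto
  obtain d y where x: "x = (d, y)"
    by fastforce
  have "0 < period_chance g h d (meeting y)"
  proof (cases y)
    case None
    then show ?thesis
      using ne(2) dummy_Keep_if_pmf_pos[of g \<sigma> h d]
      by (auto simp: x pmf_period_None period_chance_def pmf_pos)
  next
    case (Some w)
    then obtain r q a where y: "y = Some (r, q, a)"
      by (metis prod.collapse)
    then show ?thesis
      using ne(2) dummy_Keep_if_pmf_pos[of g \<sigma> h d]
      by (auto simp: x pmf_period_Some period_chance_def pmf_pos)
  qed
  then show ?case using Cons ne(1) by (simp add: x)
qed simp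

text \<open>Grim trigger with tremble rate 1/2 reaches everything that nature admits.\<close>

lemma feasible_iff: "feasible g y \<longleftrightarrow> 0 < node_chance g y"
proof
  assume "feasible g y"
  then obtain \<sigma> where "0 < reach_prob g \<sigma> y"
    by (auto simp: feasible_def)
  then show "0 < node_chance g y"
    using dummy_Keep_if_pmf_pos[of g \<sigma>] chance_pos[of g \<sigma>]
    by (cases y) (auto simp: period_chance_def pmf_pos zero_less_mult_iff less_le)
next
  assume "0 < node_chance g y"
  then have "0 < reach_prob g (grim (1 / 2)) y"
    by (simp add: reach_prob_grim)
  then show "feasible g y"
    unfolding feasible_def by blast
qed

end

section \<open>Beliefs\<close>

text \<open>What \<open>i\<close> will turn out to believe about the links she cannot observe;
  nothing is required of her own links.\<close>

definition undisturbed :: "'a network \<Rightarrow> 'a \<Rightarrow> 'a history \<Rightarrow> bool" where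
  "undisturbed g i h \<longleftrightarrow> (\<forall>k l. {k, l} \<in> g \<and> k \<noteq> i \<and> l \<noteq> i \<longrightarrow>
     {k, l} \<in> current_network g h \<and> clean_pair k l h)"

definition undisturbed_links :: "'a network \<Rightarrow> 'a \<Rightarrow> 'a network \<Rightarrow> bool" where
  "undisturbed_links g i N \<longleftrightarrow> (\<forall>k l. {k, l} \<in> g \<and> k \<noteq> i \<and> l \<noteq> i \<longrightarrow> {k, l} \<in> N)"

fun undisturbed_node :: "'a network \<Rightarrow> 'a \<Rightarrow> 'a node \<Rightarrow> bool" where
  "undisturbed_node g i (Link_Node h) \<longleftrightarrow> undisturbed g i h"
| "undisturbed_node g i (Favor_Node h d r q) \<longleftrightarrow>
     undisturbed g i h \<and> undisturbed_links g i (prune (current_network g h) d)"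

text \<open>Replacing all that player i does not take part in by intended behavior without any favors
  leaves her observations unchanged and removes the trembles of third parties.\<close>

definition erase :: "'a \<Rightarrow> 'a link_profile \<Rightarrow> 'a link_profile" where
  "erase i d = (\<lambda>(k, l). if k = i \<or> l = i then d (k, l) else Keep)"

primrec purge :: "'a \<Rightarrow> 'a history \<Rightarrow> 'a history" where
  "purge i [] = []"
| "purge i (x # h) = (erase i (fst x), own_play i (snd x)) # purge i h"

fun purge_node :: "'a \<Rightarrow> 'a node \<Rightarrow> 'a node" where
  "purge_node i (Link_Node h) = Link_Node (purge i h)"
| "purge_node i (Favor_Node h d r q) = Favor_Node (purge i h) (erase i d) r q"

lemma erase_apply: "erase i d (k, l) = (if k = i \<or> l = i then d (k, l) else Keep)"
  by (simp add: erase_def)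

lemma own_play_own_play [simp]: "own_play i (own_play i x) = own_play i x"
  by (simp add: own_play_def split: option.splits)

lemma current_network_purge:
  "{k, l} \<in> current_network g (purge i h) \<longleftrightarrow> {k, l} \<in> g \<and> (k = i \<or> l = i \<longrightarrow> {k, l} \<in> current_network g h)"
  by (induction h) (auto simp: link_in_prune_iff erase_apply)

lemma prune_purge: "{k, l} \<in> prune (current_network g (purge i h)) (erase i d)
    \<longleftrightarrow> {k, l} \<in> g \<and> (k = i \<or> l = i \<longrightarrow> {k, l} \<in> prune (current_network g h) d)"
  by (auto simp: link_in_prune_iff current_network_purge erase_apply)

lemma clean_pair_purge: "clean_pair k l (purge i h) \<longleftrightarrow> (k = i \<or> l = i \<longrightarrow> clean_pair k l h)"
proof (induction h)
  case (Cons x h)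
  then show ?case
    by (cases x) (auto simp: clean_pair_Cons own_play_def doubleton_eq_iff split: option.splits if_splits)
qed simp

lemma link_info_purge: "link_info g i (purge i h) (erase i d) = link_info g i h d"
  using current_network_subset[of g h] prune_subset[of "current_network g h" d]
  by (auto simp: link_info_def erase_apply neighbors_def prune_purge)

lemma private_history_purge: "private_history g i (purge i h) = private_history g i h"
  by (induction h) (simp_all add: link_info_purge)

lemma observed_purge:
  "moves_at i y \<Longrightarrow> moves_at i (purge_node i y) \<and> observed g i (purge_node i y) = observed g i y"
  by (cases y) (simp_all add: private_history_purge link_info_purge)

text \<open>Decisions left in place are judged as before, so purging adds no trembles. The strict
  saving is claimed only at the first disturbance: until then third-party links are clean, so
  cutting one is a tremble, whereas later cuts may merely follow grim trigger.\<close>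

lemma agreements_purge:
  fixes g :: "'a::finite network"
  shows "agreements False g (purge i h) (erase i d)
    + of_bool (undisturbed g i h \<and> \<not> undisturbed_links g i (prune (current_network g h) d))
    \<le> agreements False g h d"
proof -
  let ?A = "{(k, l). {k, l} \<in> current_network g h \<and> ((d (k, l) = Keep) = clean_pair k l h) = False}"
  let ?A' = "{(k, l). {k, l} \<in> current_network g (purge i h)
    \<and> ((erase i d (k, l) = Keep) = clean_pair k l (purge i h)) = False}"
  have A': "?A' \<subseteq> {(k, l) \<in> ?A. k = i \<or> l = i}"
    by (auto simp: current_network_purge clean_pair_purge erase_apply split: if_splits)
  show ?thesis
  proof (cases "undisturbed g i h \<and> \<not> undisturbed_links g i (prune (current_network g h) d)")
    case True
    then obtain k l where "{k, l} \<in> g" "{k, l} \<notin> prune (current_network g h) d"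
      and kl: "k \<noteq> i" "l \<noteq> i"
      unfolding undisturbed_links_def by metis
    moreover have "undisturbed g i h"
      using True ..
    then have "{k, l} \<in> current_network g h" "clean_pair k l h"
      using kl \<open>{k, l} \<in> g\<close> by (simp_all add: undisturbed_def)
    moreover have "{l, k} \<in> current_network g h" "clean_pair l k h"
      using calculation clean_pair_sym[of l k h] by (simp_all only: insert_commute[of l k])
    \<comment> \<open>The link is lost because at least one of its ends removed it, which is a
      tremble on a clean link.\<close>
    ultimately have "(k, l) \<in> ?A \<or> (l, k) \<in> ?A"
      by (auto simp: link_in_prune_iff)
    then have "?A' \<noteq> ?A"
    proof
      assume *: "(k, l) \<in> ?A"
      show ?thesis using subsetD[OF A', of "(k, l)"] * kl by auto
    next
      assume *: "(l, k) \<in> ?A"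
      show ?thesis using subsetD[OF A', of "(l, k)"] * kl by auto
    qed
    then have "?A' \<subset> ?A"
      using A' by auto
    then have "card ?A' < card ?A"
      by (intro psubset_card_mono) auto
    then show ?thesis
      using True by (simp add: agreements_def)
  next
    case False
    have "card ?A' \<le> card ?A"
      using A' by (intro card_mono) auto
    then show ?thesis
      using False by (auto simp: agreements_def)
  qed
qed

lemma favor_agreements_purge:
  "favor_agreements False (purge i h) (own_play i x)
    + of_bool (\<exists>r q. x = Some (r, q, Defect) \<and> r \<noteq> i \<and> q \<noteq> i \<and> clean_pair q r h)
    \<le> favor_agreements False h x"
  by (cases x) (auto simp: favor_agreements_def own_play_def clean_pair_purge)

lemma undisturbed_Cons: "undisturbed g i (x # h) \<longleftrightarrow>
    undisturbed g i h \<and> undisturbed_links g i (prune (current_network g h) (fst x)) \<and>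
    (\<forall>r q. snd x = Some (r, q, Defect) \<and> r \<noteq> i \<and> q \<noteq> i \<longrightarrow> {r, q} \<notin> g)"
  (is "?L \<longleftrightarrow> ?R")
proof
  assume ?L
  then show ?R
    unfolding undisturbed_def undisturbed_links_def clean_pair_Cons
    using prune_subset[of "current_network g h" "fst x"] by (simp; blast)
next
  assume R: ?R
  have "a = Cooperate" if "snd x = Some (r, q, a)" "{r, q} = {k, l}" "{k, l} \<in> g" "k \<noteq> i" "l \<noteq> i" for r q a k l
    using R that by (cases a) (auto simp: doubleton_eq_iff)
  then show ?L
    using R unfolding undisturbed_def undisturbed_links_def clean_pair_Cons by (simp; blast)
qed

text \<open>If \<open>h\<close> is disturbed already, the saving is inherited. Otherwise the new
  period contains the first disturbance, a cut or a refusal on a clean third-party link, and that is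
  a tremble which purging erases.\<close>

lemma history_agreements_purge:
  fixes g :: "'a::finite network"
  shows "history_agreements False g (purge i h) + of_bool (\<not> undisturbed g i h) \<le> history_agreements False g h"
proof (induction h)
  case Nil
  then show ?case by (simp add: undisturbed_def)
next
  case (Cons x h)
  have "\<exists>r q. snd x = Some (r, q, Defect) \<and> r \<noteq> i \<and> q \<noteq> i \<and> clean_pair q r h"
    if "undisturbed g i h" "undisturbed_links g i (prune (current_network g h) (fst x))" "\<not> undisturbed g i (x # h)"
  proof -
    from that obtain r q where "snd x = Some (r, q, Defect)" "r \<noteq> i" "q \<noteq> i" "{r, q} \<in> g"
      unfolding undisturbed_Cons by metis
    moreover have "clean_pair r q h"
      using that(1) calculation by (simp add: undisturbed_def)
    then have "clean_pair q r h"
      by (subst clean_pair_sym)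
    ultimately show ?thesis by blast
  qed
  then show ?case
    using Cons agreements_purge[of g i h "fst x"] favor_agreements_purge[of i h "snd x"]
    by (cases "undisturbed g i h"; cases "undisturbed_links g i (prune (current_network g h) (fst x))";
        cases "undisturbed g i (x # h)") (auto simp: undisturbed_Cons)
qed

lemma node_agreements_purge:
  fixes g :: "'a::finite network"
  assumes "\<not> undisturbed_node g i y"
  shows "node_agreements False g (purge_node i y) < node_agreements False g y"
proof (cases y)
  case (Link_Node h)
  then show ?thesis
    using assms history_agreements_purge[of g i h] by simp
next
  case (Favor_Node h d r q)
  then show ?thesis
    using assms history_agreements_purge[of g i h] agreements_purge[of g i h d]
    by (cases "undisturbed g i h") auto
qed

context favor_market
begin

lemma pmf_meeting_pos_iff:
  assumes "network (g :: 'a network)"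
  shows "0 < pmf (meeting_pmf g) m \<longleftrightarrow> (case m of None \<Rightarrow> True | Some (r, q) \<Rightarrow> {r, q} \<in> g)"
  using pmf_meeting_None_pos[OF assms] pmf_meeting_Some_pos[OF assms] pmf_meeting_Some[OF assms]
  by (auto split: option.splits)

lemma period_chance_pos_iff:
  assumes "network (g :: 'a network)"
  shows "0 < period_chance g h d m \<longleftrightarrow> dummy_Keep g h d \<and>
    (case m of None \<Rightarrow> True | Some (r, q) \<Rightarrow> {r, q} \<in> prune (current_network g h) d)"
  unfolding period_chance_def
  using pmf_meeting_pos_iff[OF network_prune[OF assms], of h d m] by auto

text \<open>Purged play remains feasible: the links of \<open>i\<close> are unchanged, so her own
  meetings stay possible, and other meetings are replaced by \<open>None\<close>, which always has
  positive probability.\<close>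

lemma period_chance_purge:
  assumes net: "network (g :: 'a network)" and pos: "0 < period_chance g h d m"
    and m': "m' = None \<or> m' = m \<and> (\<exists>r q. m = Some (r, q) \<and> (r = i \<or> q = i))"
  shows "0 < period_chance g (purge i h) (erase i d) m'"
proof -
  have "dummy_Keep g (purge i h) (erase i d)"
    using pos current_network_subset[of g h] unfolding period_chance_pos_iff[OF net]
    by (auto simp: dummy_Keep_def erase_apply current_network_purge)
  then show ?thesis
    using m' pos subset_trans[OF prune_subset[of "current_network g h" d] current_network_subset[of g h]]
    unfolding period_chance_pos_iff[OF net]
    by (auto simp: prune_purge)
qed

lemma chance_purge:
  assumes net: "network (g :: 'a network)"
  shows "0 < chance g h \<Longrightarrow> 0 < chance g (purge i h)"
proof (induction h)
  case (Cons x h)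
  then have pos: "0 < chance g h" "0 < period_chance g h (fst x) (meeting (snd x))"
    using chance_nonneg[of g h] by (auto simp: zero_less_mult_iff)
  have "meeting (own_play i (snd x)) = None \<or>
      meeting (own_play i (snd x)) = meeting (snd x) \<and> (\<exists>r q. meeting (snd x) = Some (r, q) \<and> (r = i \<or> q = i))"
    by (cases "snd x") (auto simp: own_play_def split: if_splits)
  from period_chance_purge[OF net pos(2) this] show ?case
    using Cons.IH[OF pos(1)] by simp
qed simp

lemma purge_node_in_info_set:
  assumes net: "network (g :: 'a network)" and "feasible g y" "moves_at i y"
  shows "purge_node i y \<in> info_set g i y"
proof -
  have "0 < node_chance g (purge_node i y)"
  proof (cases y)
    case (Link_Node h)
    then show ?thesis
      using assms chance_purge[OF net] by (simp add: feasible_iff)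
  next
    case (Favor_Node h d r q)
    then have "q = i" "0 < chance g h" "0 < period_chance g h d (Some (r, q))"
      using assms chance_nonneg[of g h] by (auto simp: feasible_iff zero_less_mult_iff)
    then show ?thesis
      using Favor_Node chance_purge[OF net] period_chance_purge[OF net, of h d "Some (r, q)" "Some (r, q)" i]
      by simp
  qed
  then show ?thesis
    using observed_purge[OF assms(3), of g] by (simp add: info_set_def feasible_iff)
qed

text \<open>Since every tremble is equally unlikely, a node reached by more trembles than another node
  of the same information set gets no weight.\<close>

lemma grim_consistent:
  assumes net: "network (g :: 'a network)"
  obtains \<mu> where "consistent g (grim 0) \<mu>"
    "\<And>i y. feasible g y \<Longrightarrow> moves_at i y \<Longrightarrow> 0 \<le> \<mu> i y"
    "\<And>i y. feasible g y \<Longrightarrow> moves_at i y \<Longrightarrow> \<not> undisturbed_node g i y \<Longrightarrow> \<mu> i y = 0"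
proof -
  \<comment> \<open>The sequence starts at 1/2 because complete mixing needs rates strictly below
    1.\<close>
  define \<epsilon> :: "nat \<Rightarrow> real" where "\<epsilon> = (\<lambda>n. inverse (real (Suc (Suc n))))"
  have \<epsilon>: "0 < \<epsilon> n" "\<epsilon> n < 1" for n
    by (simp_all add: \<epsilon>_def inverse_less_1_iff)
  have \<epsilon>_lim: "\<epsilon> \<longlonglongrightarrow> 0"
    unfolding \<epsilon>_def using LIMSEQ_inverse_real_of_nat by (rule LIMSEQ_Suc)
  let ?r = "\<lambda>i y n. reach_prob g (grim (\<epsilon> n)) y / (\<Sum>y'\<in>info_set g i y. reach_prob g (grim (\<epsilon> n)) y')"
  define \<mu> where "\<mu> = (\<lambda>i y. lim (?r i y))"
  have main: "?r i y \<longlonglongrightarrow> \<mu> i y \<and> 0 \<le> \<mu> i y \<and> (\<not> undisturbed_node g i y \<longrightarrow> \<mu> i y = 0)"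
    if y: "feasible g y" "moves_at i y" for i y
  proof -
    have y_in: "y \<in> info_set g i y"
      using y by (simp add: info_set_def)
    have pos: "0 < node_chance g y'" if "y' \<in> info_set g i y" for y'
      using that by (simp add: info_set_def feasible_iff)
    have reach: "reach_prob g (grim (\<epsilon> n)) y' = node_chance g y' * \<epsilon> n ^ node_agreements False g y'
        * (1 - \<epsilon> n) ^ node_agreements True g y'" for y' n
      using \<epsilon>[of n] by (intro reach_prob_grim) auto
    obtain L where L: "?r i y \<longlonglongrightarrow> L" "0 \<le> L"
      "\<forall>y'\<in>info_set g i y. node_agreements False g y' < node_agreements False g y \<longrightarrow> L = 0"
      using ratio_of_powers_limit[where C = "node_chance g" and a = "node_agreements False g"
            and b = "node_agreements True g", OF finite_info_set y_in pos \<epsilon>_lim \<epsilon>(1)]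
      unfolding reach by blast
    then have "\<mu> i y = L"
      by (simp add: \<mu>_def limI)
    then show ?thesis
      using L purge_node_in_info_set[OF net y] node_agreements_purge by blast
  qed
  show thesis
  proof
    show "consistent g (grim 0) \<mu>"
      unfolding consistent_def using main
      by (intro exI[of _ "\<lambda>n. grim (\<epsilon> n)"]) (auto intro: grim_totally_mixed grim_tendsto[OF \<epsilon>_lim] \<epsilon>)
  qed (use main in auto)
qed

section \<open>Networks of degree zero or B are stable\<close>

text \<open>The W of the overview: the per-period value of \<open>s\<close> links to players of
  degree \<open>B\<close>.\<close>

definition regular_utility :: "nat \<Rightarrow> nat \<Rightarrow> real" where
  "regular_utility B s = \<alpha> * v * (1 - (1 - p) ^ s) - real s * (\<alpha> * c * favor_share B)"

text \<open>The benefit of a further link falls with \<open>s\<close> while its cost is constant, so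
  the smallest increment is the one from \<open>B - 1\<close> to \<open>B\<close>, which is the one
  that the condition at \<open>B\<close> bounds.\<close>

lemma regular_utility_gain:
  assumes "cooperation_condition B" "s < B"
  shows "(1 - \<delta>) * (c - \<gamma>) \<le> \<delta> * (regular_utility B (Suc s) - regular_utility B s)"
proof -
  have "(1 - p) ^ (B - 1) \<le> (1 - p) ^ s"
    using assms(2) p_pos p_less by (intro power_decreasing) auto
  then have "\<alpha> * v * (1 - p) ^ (B - 1) * p \<le> \<alpha> * v * (1 - p) ^ s * p"
    using alpha_pos c_pos c_less p_pos by (intro mult_right_mono mult_left_mono) auto
  then have "\<alpha> * v * (1 - p) ^ (B - 1) * p - \<alpha> * c * favor_share B \<le> regular_utility B (Suc s) - regular_utility B s"
    by (simp add: regular_utility_def algebra_simps)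
  then show ?thesis
    using assms(1) delta_pos unfolding cooperation_condition_iff
    by (meson mult_le_cancel_left_pos order_trans)
qed

lemma regular_utility_less:
  assumes "cooperation_condition B" "s < s'" "s' \<le> B"
  shows "regular_utility B s < regular_utility B s'"
  using assms(2,3)
proof (induction s')
  case (Suc m)
  have "0 < (1 - \<delta>) * (c - \<gamma>)"
    using delta_less gamma_less by simp
  then have "0 < \<delta> * (regular_utility B (Suc m) - regular_utility B m)"
    using regular_utility_gain[OF assms(1), of m] Suc.prems by linarith
  then have "regular_utility B m < regular_utility B (Suc m)"
    using delta_pos by (simp add: zero_less_mult_iff)
  then show ?case
    using Suc by (cases "s = m") auto
qed simp

lemma regular_utility_le:
  assumes "0 < B \<Longrightarrow> cooperation_condition B" "s \<le> s'" "s' \<le> B"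
  shows "regular_utility B s \<le> regular_utility B s'"
  using assms regular_utility_less[of B s s'] by (cases "s = s'") auto

lemma utility_regular:
  assumes "\<And>j. j \<in> neighbors g i \<Longrightarrow> network_degree (g :: 'a network) j = B"
  shows "utility g i = regular_utility B (network_degree g i)"
  using assms by (simp add: utility_share regular_utility_def network_degree_def)

text \<open>Neighbors of lower degree turn to each of their neighbors more often, so degree
  \<open>B\<close> is the cheapest admissible one.\<close>

lemma utility_le_regular:
  assumes "\<And>j. network_degree (g :: 'a network) j \<le> B"
  shows "utility g i \<le> regular_utility B (network_degree g i)"
proof -
  have "(\<Sum>j\<in>neighbors g i. \<alpha> * c * favor_share B) \<le> (\<Sum>j\<in>neighbors g i. \<alpha> * c * favor_share (network_degree g j))"
  proof (rule sum_mono)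
    fix j assume "j \<in> neighbors g i"
    then have "0 < network_degree g j"
      using network_degree_pos[of j i g] by (simp add: mem_neighbors_iff insert_commute)
    then show "\<alpha> * c * favor_share B \<le> \<alpha> * c * favor_share (network_degree g j)"
      using assms[of j] favor_share_antimono alpha_pos c_pos by (intro mult_left_mono) auto
  qed
  then show ?thesis
    by (simp add: utility_share regular_utility_def network_degree_def)
qed

end

text \<open>The neighbors whose links to \<open>i\<close> survive the next link stage if both ends
  follow grim trigger; their number is the state variable of the value function.\<close>

definition live :: "'a network \<Rightarrow> 'a \<Rightarrow> 'a history \<Rightarrow> 'a set" where
  "live g i h = {j \<in> neighbors (current_network g h) i. clean_pair i j h}"

lemma live_Cons: "live g i ((d, x) # h) = {j \<in> neighbors (prune (current_network g h) d) i.
    clean_pair i j h \<and> (\<forall>r q. x = Some (r, q, Defect) \<longrightarrow> {r, q} \<noteq> {i, j})}"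
proof -
  have "(\<forall>r q a. x = Some (r, q, a) \<and> {r, q} = {i, j} \<longrightarrow> a = Cooperate)
      \<longleftrightarrow> (\<forall>r q. x = Some (r, q, Defect) \<longrightarrow> {r, q} \<noteq> {i, j})" for j
    using favor_decision.exhaust favor_decision.distinct by metis
  then show ?thesis
    by (auto simp: live_def clean_pair_Cons)
qed

locale semiregular_market = favor_market \<alpha> p \<delta> v c \<gamma> players
  for \<alpha> p \<delta> v c \<gamma> and players :: "'a::finite itself" +
  fixes g :: "'a network" and B :: nat
  assumes net: "network g"
    and degree: "\<And>k. network_degree g k = 0 \<or> network_degree g k = B"
    and condition: "0 < B \<Longrightarrow> cooperation_condition B"
begin

definition live_value :: "'a \<Rightarrow> 'a history \<Rightarrow> real" where
  "live_value i h = regular_utility B (card (live g i h)) / (1 - \<delta>)"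

lemma live_value_bounded: "\<bar>live_value i h\<bar> \<le> (MAX s\<in>{..CARD('a)}. \<bar>regular_utility B s / (1 - \<delta>)\<bar>)"
  unfolding live_value_def by (intro Max_ge finite_imageI imageI) (auto intro: card_mono)

lemma degree_le: "network_degree g k \<le> B"
  using degree[of k] by auto

lemma card_live_le: "card (live g i h) \<le> B"
proof -
  have "live g i h \<subseteq> neighbors g i"
    using current_network_subset[of g h] by (auto simp: live_def neighbors_def)
  then have "card (live g i h) \<le> network_degree g i"
    unfolding network_degree_def by (intro card_mono) auto
  then show ?thesis
    using degree_le[of i] by linarith
qed

lemma cooperation_pays:
  assumes "0 < n" "n \<le> B"
  shows "- \<gamma> + \<delta> * (regular_utility B (n - 1) / (1 - \<delta>)) \<le> - c + \<delta> * (regular_utility B n / (1 - \<delta>))"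
proof -
  have "(1 - \<delta>) * (c - \<gamma>) \<le> \<delta> * (regular_utility B n - regular_utility B (n - 1))"
    using regular_utility_gain[OF condition, of "n - 1"] assms by simp
  then have "c - \<gamma> \<le> \<delta> * (regular_utility B n - regular_utility B (n - 1)) / (1 - \<delta>)"
    using delta_less by (simp add: pos_le_divide_eq mult.commute)
  also have "\<dots> = \<delta> * (regular_utility B n / (1 - \<delta>)) - \<delta> * (regular_utility B (n - 1) / (1 - \<delta>))"
    by (simp add: right_diff_distrib diff_divide_distrib)
  finally show ?thesis by simp
qed

section \<open>One period of an arbitrary strategy of one player against grim trigger\<close>

context
  fixes i :: 'a and \<tau> :: "'a strategy" and \<sigma> :: "'a profile" and h :: "'a history"
  defines "\<sigma> \<equiv> (grim 0)(i := \<tau>)"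
  assumes undisturbed: "undisturbed g i h"
begin

lemma others_cooperate: "k \<noteq> i \<Longrightarrow> cooperates_if_clean g \<sigma> k"
  using grim_cooperates_if_clean[of g k] by (simp add: \<sigma>_def cooperates_if_clean_def)

lemma undisturbed_links_prune:
  assumes "d \<in> set_pmf (link_pmf g \<sigma> h)"
  shows "undisturbed_links g i (prune (current_network g h) d)"
  unfolding undisturbed_links_def
proof (intro allI impI, elim conjE)
  fix k l assume kl: "{k, l} \<in> g" "k \<noteq> i" "l \<noteq> i"
  then have "{k, l} \<in> current_network g h" "clean_pair k l h" "clean_pair l k h"
    using undisturbed clean_pair_sym[of k l h] by (simp_all add: undisturbed_def)
  then show "{k, l} \<in> prune (current_network g h) d"
    using link_profile_Keep[OF assms others_cooperate] kl by (simp add: link_in_prune_iff)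
qed

text \<open>The other end removes every link that is not clean, whatever \<open>i\<close> does.
  Since \<open>i\<close> may cut clean links too, only an inclusion holds.\<close>

lemma neighbors_prune_subset_live:
  assumes d: "d \<in> set_pmf (link_pmf g \<sigma> h)"
  shows "neighbors (prune (current_network g h) d) i \<subseteq> live g i h"
proof
  fix j assume "j \<in> neighbors (prune (current_network g h) d) i"
  then have j: "{j, i} \<in> current_network g h" "d (j, i) = Keep"
    by (simp_all add: mem_neighbors_iff link_in_prune_iff insert_commute)
  then have "j \<noteq> i"
    using network_linked_neq[OF net, of j i] current_network_subset[of g h] by blast
  moreover have "Keep \<in> set_pmf (link_choice (\<sigma> j) (private_history g j h) i)"
    using d j unfolding set_link_pmf by metis
  ultimately have "clean_pair j i h"
    by (simp add: \<sigma>_def grim_0 split: if_splits)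
  then show "j \<in> live g i h"
    using j(1) clean_pair_sym[of i j h] by (simp add: live_def mem_neighbors_iff insert_commute)
qed

text \<open>Cuts by \<open>i\<close> affect her own degree and those of the neighbors cut off. A
  remaining neighbor keeps her link to \<open>i\<close> and, by the assumption, all her other links,
  so she still has degree \<open>B\<close>.\<close>

lemma utility_prune:
  assumes "undisturbed_links g i (prune (current_network g h) d)"
  defines "N \<equiv> prune (current_network g h) d"
  shows "utility N i = regular_utility B (card (neighbors N i))"
proof -
  have N: "N \<subseteq> g"
    using prune_subset[of "current_network g h" d] current_network_subset[of g h] by (auto simp: N_def)
  have "network_degree N j = B" if j: "j \<in> neighbors N i" for j
  proof -
    have ji: "{j, i} \<in> N"
      using j by (simp add: mem_neighbors_iff insert_commute)
    then have "j \<noteq> i"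
      using network_linked_neq[OF net, of j i] N by blast
    then have "neighbors N j = neighbors g j"
      using assms(1) N ji by (auto simp: undisturbed_links_def neighbors_def N_def)
    moreover have "0 < network_degree g j"
      using network_degree_pos[of j i g] ji N by blast
    ultimately show ?thesis
      using degree[of j] by (auto simp: network_degree_def)
  qed
  then show ?thesis
    using utility_regular[of N i B] by (simp add: network_degree_def)
qed

text \<open>There is no contagion: third parties condition on their bilateral histories, which no
  deviation of \<open>i\<close> touches.\<close>

lemma undisturbed_step:
  assumes "x \<in> set_pmf (period_pmf g \<sigma> h)"
  shows "undisturbed g i (x # h)"
  using assms
proof (rule set_period_pmf[OF net])
  fix d assume "d \<in> set_pmf (link_pmf g \<sigma> h)" "x = (d, None)"
  then show ?thesis
    using undisturbed undisturbed_links_prune by (simp add: undisturbed_Cons)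
next
  fix d r q a
  assume d: "d \<in> set_pmf (link_pmf g \<sigma> h)" and x: "x = (d, Some (r, q, a))"
    and rq: "{r, q} \<in> prune (current_network g h) d" and a: "a \<in> set_pmf (favor_pmf g \<sigma> h d r q)"
  have "a = Cooperate" if "r \<noteq> i" "q \<noteq> i" "{r, q} \<in> g"
    using favor_pmf_Cooperate[OF others_cooperate[OF that(2)] that(3)] a undisturbed that by (simp add: undisturbed_def)
  then show ?thesis
    using undisturbed undisturbed_links_prune[OF d] x by (auto simp: undisturbed_Cons)
qed

lemma period_value_Cooperate:
  assumes "neighbors (prune (current_network g h) d) i \<subseteq> live g i h"
    and "\<And>r q. x = Some (r, q, Defect) \<Longrightarrow> r \<noteq> i \<and> q \<noteq> i"
  shows "live_value i ((d, x) # h) = regular_utility B (card (neighbors (prune (current_network g h) d) i)) / (1 - \<delta>)"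
proof -
  have "{r, q} \<noteq> {i, j}" if "x = Some (r, q, Defect)" for r q j
    using assms(2)[OF that] by auto
  moreover have "clean_pair i j h" if "j \<in> neighbors (prune (current_network g h) d) i" for j
    using assms(1) that by (auto simp: live_def)
  ultimately have "live g i ((d, x) # h) = neighbors (prune (current_network g h) d) i"
    unfolding live_Cons by blast
  then show ?thesis by (simp add: live_value_def)
qed

text \<open>Cutting live links loses value by monotonicity of \<open>regular_utility\<close>, and
  refusing a favor trades \<open>c - \<gamma>\<close> for one live link, which
  \<open>cooperation_pays\<close> shows to be unprofitable.\<close>

lemma bellman_le: "measure_pmf.expectation (period_pmf g \<sigma> h) (\<lambda>x. payoff i x + \<delta> * live_value i (x # h))
    \<le> live_value i h"
proof (rule expectation_period_le[OF net])
  fix d assume d: "d \<in> set_pmf (link_pmf g \<sigma> h)"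
  let ?N = "prune (current_network g h) d"
  let ?K = "\<lambda>d. \<delta> * (regular_utility B (card (neighbors (prune (current_network g h) d) i)) / (1 - \<delta>))"
  note sub = neighbors_prune_subset_live[OF d]
  have card_le: "card (neighbors ?N i) \<le> card (live g i h)"
    using sub by (intro card_mono) auto
  show "payoff i (d, None) + \<delta> * live_value i ((d, None) # h) \<le> ?K d"
    using period_value_Cooperate[OF sub, of None] by (simp add: payoff_simps)
  have "?K d + utility ?N i = regular_utility B (card (neighbors ?N i)) / (1 - \<delta>)"
    using utility_prune[OF undisturbed_links_prune[OF d]] delta_less by (simp add: field_simps)
  also have "\<dots> \<le> live_value i h"
    unfolding live_value_def using delta_less condition card_le card_live_le
    by (intro divide_right_mono regular_utility_le) auto
  finally show "?K d + utility ?N i \<le> live_value i h" .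
  fix r q a assume rq: "{r, q} \<in> ?N" and a: "a \<in> set_pmf (favor_pmf g \<sigma> h d r q)"
  have neq: "r \<noteq> q"
    using network_linked_neq[OF network_prune[OF net] rq] .
  show "payoff i (d, Some (r, q, a)) + \<delta> * live_value i ((d, Some (r, q, a)) # h)
      \<le> ?K d + meeting_payoff i (Some (r, q))"
  proof (cases a)
    case Cooperate
    then show ?thesis
      using period_value_Cooperate[OF sub, of "Some (r, q, a)"] by (simp add: payoff_simps)
  next
    case Defect
    \<comment> \<open>Surviving links of \<open>i\<close> are live, and on these the other end
      provides; so \<open>i\<close> is never the one refused.\<close>
    have "r \<noteq> i"
    proof
      assume "r = i"
      then have "q \<in> live g i h"
        using rq sub by (auto simp: mem_neighbors_iff)
      then have "clean_pair r q h" "{r, q} \<in> g"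
        using \<open>r = i\<close> current_network_subset[of g h] by (auto simp: live_def mem_neighbors_iff)
      then show False
        using favor_pmf_Cooperate[OF others_cooperate, of q r h d] neq \<open>r = i\<close> a Defect by simp
    qed
    show ?thesis
    proof (cases "q = i")
      case False
      then show ?thesis
        using period_value_Cooperate[OF sub, of "Some (r, q, a)"] \<open>r \<noteq> i\<close> Defect
        by (simp add: payoff_simps meeting_payoff_def)
    next
      case True
      then have r: "r \<in> neighbors ?N i"
        using rq by (simp add: mem_neighbors_iff insert_commute)
      have "clean_pair i j h" if "j \<in> neighbors ?N i" for j
        using sub that by (auto simp: live_def)
      moreover have "(\<forall>r' q'. Some (r, q, a) = Some (r', q', Defect) \<longrightarrow> {r', q'} \<noteq> {i, j}) \<longleftrightarrow> j \<noteq> r" for j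
        using True Defect \<open>r \<noteq> i\<close> by (auto simp: doubleton_eq_iff)
      ultimately have "live g i ((d, Some (r, q, a)) # h) = neighbors ?N i - {r}"
        unfolding live_Cons by blast
      then have "card (live g i ((d, Some (r, q, a)) # h)) = card (neighbors ?N i) - 1"
        using r by simp
      moreover have "0 < card (neighbors ?N i)"
        using r by (metis card_gt_0_iff empty_iff finite_code)
      ultimately show ?thesis
        using cooperation_pays[of "card (neighbors ?N i)"] card_le card_live_le[of i h] True Defect \<open>r \<noteq> i\<close>
        by (simp add: payoff_simps meeting_payoff_def live_value_def)
    qed
  qed
qed

text \<open>If \<open>i\<close> follows grim trigger as well, exactly the live links survive and
  every favor requested on them is provided, so no inequality is lost.\<close>

lemma bellman_eq:
  assumes "\<tau> = grim 0 i"
  shows "measure_pmf.expectation (period_pmf g \<sigma> h) (\<lambda>x. payoff i x + \<delta> * live_value i (x # h)) = live_value i h"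
proof (rule expectation_period_eq[OF net])
  have coop': "cooperates_if_clean g \<sigma> k" for k
    using assms grim_cooperates_if_clean[of g k] by (simp add: \<sigma>_def)
  fix d assume d: "d \<in> set_pmf (link_pmf g \<sigma> h)"
  let ?N = "prune (current_network g h) d"
  let ?K = "\<lambda>d. \<delta> * (regular_utility B (card (neighbors (prune (current_network g h) d) i)) / (1 - \<delta>))"
  note sub = neighbors_prune_subset_live[OF d]
  have "live g i h \<subseteq> neighbors ?N i"
  proof
    fix j assume j: "j \<in> live g i h"
    then have "clean_pair i j h" "clean_pair j i h"
      using clean_pair_sym[of i j h] by (simp_all add: live_def)
    then show "j \<in> neighbors ?N i"
      using j link_profile_Keep[OF d coop'] by (simp add: live_def mem_neighbors_iff link_in_prune_iff)
  qed
  then have live: "neighbors ?N i = live g i h"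
    using sub by blast
  show "payoff i (d, None) + \<delta> * live_value i ((d, None) # h) = ?K d"
    using period_value_Cooperate[OF sub, of None] by (simp add: payoff_simps)
  show "?K d + utility ?N i = live_value i h"
    using utility_prune[OF undisturbed_links_prune[OF d]] delta_less by (simp add: live_value_def live field_simps)
  fix r q a assume rq: "{r, q} \<in> ?N" and a: "a \<in> set_pmf (favor_pmf g \<sigma> h d r q)"
  have rq_g: "{r, q} \<in> g"
    using rq prune_subset[of "current_network g h" d] current_network_subset[of g h] by blast
  have "clean_pair r q h"
  proof (cases "r = i \<or> q = i")
    case True
    then have "r = i \<and> q \<in> neighbors ?N i \<or> q = i \<and> r \<in> neighbors ?N i"
      using rq by (auto simp: mem_neighbors_iff insert_commute)
    then show ?thesis
      using sub clean_pair_sym[of r q h] by (auto simp: live_def)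
  next
    case False
    then show ?thesis
      using undisturbed rq_g by (simp add: undisturbed_def)
  qed
  then have "a = Cooperate"
    using favor_pmf_Cooperate[OF coop' rq_g] a by simp
  then show "payoff i (d, Some (r, q, a)) + \<delta> * live_value i ((d, Some (r, q, a)) # h)
      = ?K d + meeting_payoff i (Some (r, q))"
    using period_value_Cooperate[OF sub, of "Some (r, q, a)"] by (simp add: payoff_simps)
qed

end

lemma deviation_payoff_le:
  "undisturbed g i h \<Longrightarrow> discounted_payoff g ((grim 0)(i := \<tau>)) i h \<le> live_value i h"
  by (rule discounted_payoff_le[where P = "undisturbed g i", OF _ undisturbed_step bellman_le live_value_bounded])

lemma grim_payoff_ge:
  assumes "undisturbed g i h"
  shows "live_value i h \<le> discounted_payoff g (grim 0) i h"
  using assms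
proof (rule discounted_payoff_ge[where P = "undisturbed g i", OF _ _ _ live_value_bounded])
  show "undisturbed g i (x # h)" if "undisturbed g i h" "x \<in> set_pmf (period_pmf g (grim 0) h)" for h x
    using undisturbed_step[of i h x "grim 0 i"] that by simp
  show "live_value i h \<le> measure_pmf.expectation (period_pmf g (grim 0) h) (\<lambda>x. payoff i x + \<delta> * live_value i (x # h))"
    if "undisturbed g i h" for h
    using bellman_eq[OF that refl] by simp
qed

lemma node_payoff_le:
  assumes "feasible g y" "moves_at i y" "undisturbed_node g i y"
  shows "node_payoff g ((grim 0)(i := \<tau>)) i y \<le> node_payoff g (grim 0) i y"
proof (cases y)
  case (Link_Node h)
  then show ?thesis
    using deviation_payoff_le[of i h \<tau>] grim_payoff_ge[of i h] assms(3) by simp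
next
  case (Favor_Node h d r q)
  let ?N = "prune (current_network g h) d"
  let ?\<sigma> = "(grim 0)(i := \<tau>)"
  let ?a = "if clean_pair i r h then Cooperate else Defect"
  let ?x = "\<lambda>a. (d, Some (r, i, a))"
  let ?G = "\<lambda>a. payoff i (?x a) + \<delta> * live_value i (?x a # h)"
  let ?X = "{j \<in> neighbors ?N i. clean_pair i j h}"
  have q: "q = i" and undist: "undisturbed g i h" "undisturbed_links g i ?N"
    using assms Favor_Node by simp_all
  have "0 < period_chance g h d (Some (r, i))"
    using assms(1) Favor_Node q chance_nonneg[of g h] by (auto simp: feasible_iff zero_less_mult_iff)
  then have ri: "{r, i} \<in> ?N"
    by (simp add: period_chance_pos_iff[OF net])
  have neq: "r \<noteq> i"
    using network_linked_neq[OF network_prune[OF net] ri] .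
  have undist': "undisturbed g i (?x a # h)" for a
    using undist by (simp add: undisturbed_Cons)
  have live: "live g i (?x Cooperate # h) = ?X" "live g i (?x Defect # h) = ?X - {r}"
    by (auto simp: live_Cons doubleton_eq_iff)
  have best: "?G a \<le> ?G ?a" for a
  proof (cases "clean_pair i r h")
    case True
    then have r: "r \<in> ?X"
      using ri by (simp add: mem_neighbors_iff insert_commute)
    then have "0 < card ?X"
      by (metis (no_types, lifting) card_gt_0_iff empty_iff finite_code)
    moreover have "card ?X \<le> B"
      using card_live_le[of i "?x Cooperate # h"] by (simp only: live)
    ultimately have "?G Defect \<le> ?G Cooperate"
      using cooperation_pays[of "card ?X"] r neq unfolding live_value_def live
      by (simp add: payoff_simps meeting_payoff_def)
    then show ?thesis
      using True by (cases a) simp_all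
  next
    case False
    \<comment> \<open>A link with a past defection gets here only if both ends failed to cut it. It
      is not live after either choice, so the continuation value is the same and refusing saves
      \<open>c - \<gamma>\<close>.\<close>
    then have "?X - {r} = ?X"
      by auto
    then have "?G Cooperate \<le> ?G Defect"
      using gamma_less neq unfolding live_value_def live
      by (simp add: payoff_simps meeting_payoff_def)
    then show ?thesis
      using False by (cases a) simp_all
  qed
  have "node_payoff g ?\<sigma> i y = measure_pmf.expectation (favor_pmf g ?\<sigma> h d r i)
      (\<lambda>a. payoff i (?x a) + \<delta> * discounted_payoff g ?\<sigma> i (?x a # h))"
    using Favor_Node q by simp
  also have "\<dots> \<le> ?G ?a"
  proof (rule expectation_pmf_le_const)
    fix a
    have "payoff i (?x a) + \<delta> * discounted_payoff g ?\<sigma> i (?x a # h) \<le> ?G a"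
      using deviation_payoff_le[OF undist'] delta_pos by simp
    then show "payoff i (?x a) + \<delta> * discounted_payoff g ?\<sigma> i (?x a # h) \<le> ?G ?a"
      using best[of a] by linarith
  qed simp
  also have "\<dots> \<le> payoff i (?x ?a) + \<delta> * discounted_payoff g (grim 0) i (?x ?a # h)"
    using grim_payoff_ge[OF undist'] delta_pos by simp
  also have "\<dots> = node_payoff g (grim 0) i y"
    using Favor_Node q by (simp add: favor_pmf_def grim_0)
  finally show ?thesis .
qed

lemma grim_cooperative_on_path: "cooperative_on_path g (grim 0)"
proof -
  let ?P = "\<lambda>h. \<forall>(d, x)\<in>set h. (\<forall>e. d e = Keep) \<and> (\<forall>r q a. x = Some (r, q, a) \<longrightarrow> a = Cooperate)"
  have "?P h" if "h \<in> set_pmf (run g (grim 0) [] k)" for h k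
    using _ _ that
  proof (rule run_invariant)
    fix h :: "'a history" and x
    assume P: "?P h" and x: "x \<in> set_pmf (period_pmf g (grim 0) h)"
    have clean: "clean_pair k l h" for k l
      using P by (fastforce simp: clean_pair_def)
    have link: "link_pmf g (grim 0) h = return_pmf (\<lambda>_. Keep)"
      using clean grim_cooperates_if_clean by (intro link_pmf_all_clean) auto
    have favor: "favor_pmf g (grim 0) h d r q = return_pmf Cooperate" for d r q
      using clean by (simp add: favor_pmf_def grim_0)
    from x show "?P (x # h)"
      by (rule set_period_pmf[OF net]) (use P link favor in auto)
  qed simp
  then show ?thesis
    unfolding cooperative_on_path_def by blast
qed

text \<open>Grim trigger is optimal at each undisturbed node separately, so the belief matters only
  through its support and the sums compare term by term.\<close>

theorem stable: "stable g"
proof -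
  obtain \<mu> where \<mu>: "consistent g (grim 0) \<mu>"
    "\<And>i y. feasible g y \<Longrightarrow> moves_at i y \<Longrightarrow> 0 \<le> \<mu> i y"
    "\<And>i y. feasible g y \<Longrightarrow> moves_at i y \<Longrightarrow> \<not> undisturbed_node g i y \<Longrightarrow> \<mu> i y = 0"
    using grim_consistent[OF net] by blast
  have "sequentially_rational g (grim 0) \<mu>"
    unfolding sequentially_rational_def
  proof (intro allI impI sum_mono)
    fix i y \<tau> y' assume "y' \<in> info_set g i y"
    then have y': "feasible g y'" "moves_at i y'"
      by (simp_all add: info_set_def)
    show "\<mu> i y' * node_payoff g ((grim 0)(i := \<tau>)) i y' \<le> \<mu> i y' * node_payoff g (grim 0) i y'"
    proof (cases "undisturbed_node g i y'")
      case True
      then show ?thesis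
        using node_payoff_le[OF y'] \<mu>(2)[OF y'] by (intro mult_left_mono) auto
    next
      case False
      then show ?thesis
        using \<mu>(3)[OF y'] by simp
    qed
  qed
  then have "bilateral_equilibrium g (grim 0)"
    using \<mu>(1) grim_bilaterally_measurable unfolding bilateral_equilibrium_def by blast
  then show ?thesis
    using net grim_cooperative_on_path unfolding stable_def by blast
qed

end

section \<open>Constrained efficiency\<close>

context favor_market
begin

lemma stable_if_semiregular:
  assumes "network (g :: 'a network)" "cooperation_bound B"
    "\<And>k. network_degree g k = 0 \<or> network_degree g k = B"
  shows "stable g"
proof -
  interpret semiregular_market \<alpha> p \<delta> v c \<gamma> players g B
    using assms by unfold_locales (auto simp: cooperation_bound_def)
  show ?thesis by (rule stable)
qed

text \<open>The clique is built around the given \<open>i\<close>: efficiency compares players one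
  at a time, so each may have her own comparison network.\<close>

lemma stable_clique:
  fixes i :: 'a
  assumes bound: "cooperation_bound B" and B: "B < CARD('a)"
  obtains g where "stable g" "utility g i = regular_utility B B"
proof -
  have "B \<le> card (UNIV - {i})"
    using B by (simp add: card_Diff_singleton)
  then obtain T where T: "T \<subseteq> UNIV - {i}" "card T = B"
    by (meson obtain_subset_with_card_n)
  define S where "S = insert i T"
  define g where "g = {e. e \<subseteq> S \<and> card e = 2}"
  have S: "i \<in> S" "card S = Suc B"
    using T by (auto simp: S_def card_insert_if)
  have net: "network g"
    by (simp add: network_def g_def)
  have N: "neighbors g k = (if k \<in> S then S - {k} else {})" for k
    by (auto simp: neighbors_def g_def card_2_iff doubleton_eq_iff)
  have deg: "network_degree g k = (if k \<in> S then B else 0)" for k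
    using S by (simp add: network_degree_def N)
  show thesis
  proof
    show "stable g"
      using stable_if_semiregular[OF net bound] deg by simp
    show "utility g i = regular_utility B B"
      using utility_regular[of g i B] S by (simp add: deg N)
  qed
qed

theorem constrained_efficient_iff:
  assumes bound: "cooperation_bound B" and B: "B < CARD('a)" and net: "network (g :: 'a network)"
  shows "constrained_efficient g \<longleftrightarrow> (\<forall>i. network_degree g i = B)"
proof
  assume eff: "constrained_efficient g"
  then have "stable g"
    by (simp add: constrained_efficient_def)
  then have le: "network_degree g k \<le> B" for k
    by (rule stable_degree_le[OF bound])
  show "\<forall>i. network_degree g i = B"
  proof
    fix i
    obtain g' :: "'a network" where "stable g'" "utility g' i = regular_utility B B"
      by (rule stable_clique[OF bound B])
    then have "regular_utility B B \<le> utility g i"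
      using eff unfolding constrained_efficient_def by metis
    also have "\<dots> \<le> regular_utility B (network_degree g i)"
      using le by (rule utility_le_regular)
    finally have "\<not> regular_utility B (network_degree g i) < regular_utility B B"
      by simp
    then have "\<not> network_degree g i < B"
      using bound regular_utility_less[of B "network_degree g i" B] by (auto simp: cooperation_bound_def)
    then show "network_degree g i = B"
      using le[of i] by simp
  qed
next
  assume deg: "\<forall>i. network_degree g i = B"
  have "utility g' i \<le> utility g i" if "stable g'" for g' i
  proof -
    have le: "network_degree g' k \<le> B" for k
      by (rule stable_degree_le[OF bound that])
    have "utility g' i \<le> regular_utility B (network_degree g' i)"
      using le by (rule utility_le_regular)
    also have "\<dots> \<le> regular_utility B B"
      using bound le by (intro regular_utility_le) (auto simp: cooperation_bound_def)
    also have "\<dots> = utility g i"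
      using utility_regular[of g i B] deg by simp
    finally show ?thesis .
  qed
  moreover have "stable g"
    using stable_if_semiregular[OF net bound] deg by simp
  ultimately show "constrained_efficient g"
    by (simp add: constrained_efficient_def)
qed

end

text \<open>\<open>real CARD('a) * \<alpha> \<le> 1\<close> makes room for at most one requester per
  period with chance \<open>\<alpha>\<close> each. \<open>B < CARD('a)\<close> lets a clique of
  \<open>B + 1\<close> players fit; for larger \<open>B\<close> no network on these players has all
  degrees \<open>B\<close>.\<close>

theorem corollary1:
  fixes \<alpha> p \<delta> v c \<gamma> :: real
    and B :: nat
    and g :: "'a::finite network"
  assumes "0 < \<alpha>" "\<alpha> \<le> 1" and "real CARD('a) * \<alpha> \<le> 1"
    and "0 < p" "p < 1"
    and "0 < \<delta>" "\<delta> < 1"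
    and "0 < c" "c < v"
    and "0 \<le> \<gamma>" "\<gamma> < c"
    and "favor_exchange.cooperation_bound \<alpha> p \<delta> v c \<gamma> B"
    and "B < CARD('a)"
    and "network g"
  shows "favor_exchange.constrained_efficient \<alpha> p \<delta> v c \<gamma> g \<longleftrightarrow> (\<forall>i. network_degree g i = B)"
proof -
  interpret favor_market \<alpha> p \<delta> v c \<gamma> "TYPE('a)"
    using assms by unfold_locales
  show ?thesis
    using assms by (intro constrained_efficient_iff)
qed

end
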